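(* Let $\epsilon,\tau>0$ with $\epsilon+\tau\le1$, let $N$ be a positive integer, and let $T=F_T(\hat T)$ be a representative curved element of type A, B, C or D with parameters $(\epsilon,\tau,N)$. Let $\boldsymbol{u}(\boldsymbol{x})=\frac{r(|\boldsymbol{x}|)}{|\boldsymbol{x}|}\boldsymbol{x}$ be a cavity deformation and let $\Pi\boldsymbol{u}$ be its quadratic iso-parametric interpolation function on $T$. Then the error between the Jacobian determinants of $\boldsymbol{u}$ and $\Pi\boldsymbol{u}$ at $\boldsymbol{x}=F_T(\hat{\boldsymbol{x}})$, $\hat{\boldsymbol{x}}\in\hat T$, satisfies $$\det\frac{\partial\Pi\boldsymbol{u}}{\partial\boldsymbol{x}}(\hat{\boldsymbol{x}})-\det\frac{\partial\boldsymbol{u}}{\partial\boldsymbol{x}}(\hat{\boldsymbol{x}})=\frac{O(\tau^3N^{-1}+(\epsilon+\tau)\tau N^{-3}+N^{-5})}{\det\nabla\boldsymbol{x}}=O\Big(N^{-2}+\frac{\tau^2}{\epsilon}+\frac{N^{-4}}{\epsilon\tau}\Big),$$ where $\det\nabla\boldsymbol{x}=\det\frac{\partial F_T}{\partial\hat{\boldsymbol{x}}}(\hat{\boldsymbol{x}})$, and $\det\frac{\partial\Pi\boldsymbol{u}}{\partial\boldsymbol{x}}(\hat{\boldsymbol{x}})$, $\det\frac{\partial\boldsymbol{u}}{\partial\boldsymbol{x}}(\hat{\boldsymbol{x}})$ denote the Jacobian determinants with respect to $\boldsymbol{x}$ evaluated at $\boldsymbol{x}=F_T(\hat{\boldsy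mbol{x}})$.
   Context: Cavity deformation: $\boldsymbol{u}(\boldsymbol{x})=\frac{r(|\boldsymbol{x}|)}{|\boldsymbol{x}|}\boldsymbol{x}$ on $\mathbb{R}^2$ points with $0<|\boldsymbol{x}|\le1$, where $r$ is defined on $(0,1]$ and is smooth, positive, increasing and convex, with $r^{(j)}$ bounded for $j=0,1,2,3$, $\inf_{R\in(0,1]}r(R)>0$, and $mR\le r'(R)\le MR$ for some constants $0<m<M$. Reference element: $\hat T=\{(\hat x_1,\hat x_2):\hat x_1,\hat x_2\ge 0,\ \hat x_1+\hat x_2\le 1\}$, with barycentric coordinates $\hat\lambda_1=1-\hat x_1-\hat x_2$, $\hat\lambda_2=\hat x_1$, $\hat\lambda_3=\hat x_2$, and quadratic shape functions $\hat\mu_i=\hat\lambda_i(2\hat\lambda_i-1)$ ($1\le i\le 3$), $\hat\mu_{ij}=4\hat\lambda_i\hat\lambda_j$ ($1\le i<j\le 3$). Given points $\boldsymbol{a}_i,\boldsymbol{a}_{ij}\in\mathbb{R}^2$, the quadratic map is $F_T(\hat{\boldsymbol{x}})=\sum_{i=1}^3\boldsymbol{a}_i\hat\mu_i(\hat{\boldsymbol{x}})+\sum_{1\le i<j\le3}\boldsymbol{a}_{ij}\hat\mu_{ij}(\hat{\boldsymbol{x}})$, and $T=F_T(\hat T)$ is a curved triangular element. Interpolation: for $\boldsymbol{x}=F_T(\hat{\boldsymbol{x}})$, $\Pi\boldsymbol{u}(\boldsymbol{x})=\sum_{i=1}^3\boldsymbol{u}(\boldsymbol{a}_i)\hat\mu_i(\hat{\boldsymbol{x}})+\sum_{1\le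 i<j\le3}\boldsymbol{u}(\boldsymbol{a}_{ij})\hat\mu_{ij}(\hat{\boldsymbol{x}})$. Representative elements with parameters $(\epsilon,\tau,N)$: for $t>0$ and $\alpha\in\mathbb{R}$ write $P(t,\alpha)=t(\cos\alpha,\sin\alpha)$, and put $t_0=\epsilon$, $t_{1/2}=\epsilon+\tau/2$, $t_1=\epsilon+\tau$. Type A: $\boldsymbol{a}_1=P(t_0,0)$, $\boldsymbol{a}_2=P(t_1,-\frac{\pi}{N})$, $\boldsymbol{a}_3=P(t_1,\frac{\pi}{N})$, $\boldsymbol{a}_{12}=P(t_{1/2},-\frac{\pi}{2N})$, $\boldsymbol{a}_{13}=P(t_{1/2},\frac{\pi}{2N})$, $\boldsymbol{a}_{23}=P(t_1,0)$. Type B: $\boldsymbol{a}_1=P(t_1,0)$, $\boldsymbol{a}_2=P(t_0,\frac{\pi}{N})$, $\boldsymbol{a}_3=P(t_0,-\frac{\pi}{N})$, $\boldsymbol{a}_{12}=P(t_{1/2},\frac{\pi}{2N})$, $\boldsymbol{a}_{13}=P(t_{1/2},-\frac{\pi}{2N})$, $\boldsymbol{a}_{23}=P(t_0,0)$. Type C: $\boldsymbol{a}_1=P(t_0,0)$, $\boldsymbol{a}_2=P(t_1,0)$, $\boldsymbol{a}_3=P(t_0,\frac{\pi}{N})$, $\boldsymbol{a}_{12}=P(t_{1/2},0)$, $\boldsymbol{a}_{13}=P(t_0,\frac{\pi}{2N})$, $\boldsymbol{a}_{23}=P(t_{1/2},\frac{\pi}{2N})$. Type D: $\boldsymbol{a}_1=P(t_0,0)$,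 $\boldsymbol{a}_2=P(t_0,-\frac{\pi}{N})$, $\boldsymbol{a}_3=P(t_1,0)$, $\boldsymbol{a}_{12}=P(t_0,-\frac{\pi}{2N})$, $\boldsymbol{a}_{13}=P(t_{1/2},0)$, $\boldsymbol{a}_{23}=P(t_{1/2},-\frac{\pi}{2N})$. $O(\Psi)$ denotes a quantity bounded in absolute value by $C\Psi$, with a generic constant $C$ (which may depend on $r$) independent of $\epsilon$, $\tau$, $N$ and $\hat{\boldsymbol{x}}$.
   Formalization: For types A and B the second bound is claimed only when τN^4 ≥ Kε for some absolute constant K>0, since uniformly it fails as det∇x→0; F_T is taken injective on T̂, with 0<|x|≤1 and det∇x≠0 at x̂, so that Πu, u and the quotient are defined. *)

theory Defs
  imports "HOL-Analysis.Analysis"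
begin

text \<open>
  Derivatives of a profile on \<open>(0,1]\<close> are taken within \<open>(0,1]\<close>, i.e. one-sided at \<open>1\<close>; the values of
  a profile outside \<open>(0,1]\<close> are irrelevant.
\<close>

definition profile_deriv :: "nat \<Rightarrow> (real \<Rightarrow> real) \<Rightarrow> real \<Rightarrow> real" where
  "profile_deriv j = ((\<lambda>f R. vector_derivative f (at R within {0<..1})) ^^ j)"

definition smooth_profile :: "(real \<Rightarrow> real) \<Rightarrow> bool" where
  "smooth_profile r \<longleftrightarrow>
     (\<forall>j. \<forall>R\<in>{0<..1}. (profile_deriv j r has_real_derivative profile_deriv (Suc j) r R)
                          (at R within {0<..1}))"

definition cavity_profile :: "(real \<Rightarrow> real) \<Rightarrow> bool" where
  "cavity_profile r \<longleftrightarrow>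
     smooth_profile r \<and>
     (\<forall>R\<in>{0<..1}. 0 < r R) \<and>
     mono_on {0<..1} r \<and>
     convex_on {0<..1} r \<and>
     (\<forall>j\<le>3. bounded (profile_deriv j r ` {0<..1})) \<and>
     0 < (INF R\<in>{0<..1}. r R) \<and>
     (\<exists>m M. 0 < m \<and> m < M \<and>
        (\<forall>R\<in>{0<..1}. m * R \<le> profile_deriv 1 r R \<and> profile_deriv 1 r R \<le> M * R))"

definition punctured_disc :: "(real^2) set" where
  "punctured_disc = {x. 0 < norm x \<and> norm x \<le> 1}"

definition cavity_map :: "(real \<Rightarrow> real) \<Rightarrow> real^2 \<Rightarrow> real^2" where
  "cavity_map r x = (r (norm x) / norm x) *\<^sub>R x"

definition ref_triangle :: "(real^2) set" where
  "ref_triangle = {x. 0 \<le> x$1 \<and> 0 \<le> x$2 \<and> x$1 + x$2 \<le> 1}"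

datatype node = V1 | V2 | V3 | M12 | M13 | M23

definition bary1 :: "real^2 \<Rightarrow> real" where "bary1 x = 1 - x$1 - x$2"
definition bary2 :: "real^2 \<Rightarrow> real" where "bary2 x = x$1"
definition bary3 :: "real^2 \<Rightarrow> real" where "bary3 x = x$2"

fun shape_fun :: "node \<Rightarrow> real^2 \<Rightarrow> real" where
  "shape_fun V1 x = bary1 x * (2 * bary1 x - 1)"
| "shape_fun V2 x = bary2 x * (2 * bary2 x - 1)"
| "shape_fun V3 x = bary3 x * (2 * bary3 x - 1)"
| "shape_fun M12 x = 4 * bary1 x * bary2 x"
| "shape_fun M13 x = 4 * bary1 x * bary3 x"
| "shape_fun M23 x = 4 * bary2 x * bary3 x"

definition quad_map :: "(node \<Rightarrow> real^2) \<Rightarrow> real^2 \<Rightarrow> real^2" where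
  "quad_map a x = (\<Sum>n\<in>{V1, V2, V3, M12, M13, M23}. shape_fun n x *\<^sub>R a n)"

text \<open>
  The interpolant is a function of the physical point \<open>x\<close>. On the element \<open>quad_map a ` ref_triangle\<close>
  it is well defined by its values \<open>quad_map (u \<circ> a) y\<close> at \<open>quad_map a y\<close> as soon as \<open>quad_map a\<close> is
  injective on \<open>ref_triangle\<close>.
\<close>

definition iso_interp :: "(real^2 \<Rightarrow> real^2) \<Rightarrow> (node \<Rightarrow> real^2) \<Rightarrow> real^2 \<Rightarrow> real^2" where
  "iso_interp u a x = quad_map (u \<circ> a) (inv_into ref_triangle (quad_map a) x)"

definition polar_pt :: "real \<Rightarrow> real \<Rightarrow> real^2" where
  "polar_pt t \<alpha> = vector [t * cos \<alpha>, t * sin \<alpha>]"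

datatype element_type = Type_A | Type_B | Type_C | Type_D

fun rep_node :: "element_type \<Rightarrow> real \<Rightarrow> real \<Rightarrow> nat \<Rightarrow> node \<Rightarrow> real^2" where
  "rep_node Type_A \<epsilon> \<tau> N V1 = polar_pt \<epsilon> 0"
| "rep_node Type_A \<epsilon> \<tau> N V2 = polar_pt (\<epsilon> + \<tau>) (- pi / real N)"
| "rep_node Type_A \<epsilon> \<tau> N V3 = polar_pt (\<epsilon> + \<tau>) (pi / real N)"
| "rep_node Type_A \<epsilon> \<tau> N M12 = polar_pt (\<epsilon> + \<tau> / 2) (- pi / (2 * real N))"
| "rep_node Type_A \<epsilon> \<tau> N M13 = polar_pt (\<epsilon> + \<tau> / 2) (pi / (2 * real N))"
| "rep_node Type_A \<epsilon> \<tau> N M23 = polar_pt (\<epsilon> + \<tau>) 0"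

| "rep_node Type_B \<epsilon> \<tau> N V1 = polar_pt (\<epsilon> + \<tau>) 0"
| "rep_node Type_B \<epsilon> \<tau> N V2 = polar_pt \<epsilon> (pi / real N)"
| "rep_node Type_B \<epsilon> \<tau> N V3 = polar_pt \<epsilon> (- pi / real N)"
| "rep_node Type_B \<epsilon> \<tau> N M12 = polar_pt (\<epsilon> + \<tau> / 2) (pi / (2 * real N))"
| "rep_node Type_B \<epsilon> \<tau> N M13 = polar_pt (\<epsilon> + \<tau> / 2) (- pi / (2 * real N))"
| "rep_node Type_B \<epsilon> \<tau> N M23 = polar_pt \<epsilon> 0"

| "rep_node Type_C \<epsilon> \<tau> N V1 = polar_pt \<epsilon> 0"
| "rep_node Type_C \<epsilon> \<tau> N V2 = polar_pt (\<epsilon> + \<tau>) 0"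
| "rep_node Type_C \<epsilon> \<tau> N V3 = polar_pt \<epsilon> (pi / real N)"
| "rep_node Type_C \<epsilon> \<tau> N M12 = polar_pt (\<epsilon> + \<tau> / 2) 0"
| "rep_node Type_C \<epsilon> \<tau> N M13 = polar_pt \<epsilon> (pi / (2 * real N))"
| "rep_node Type_C \<epsilon> \<tau> N M23 = polar_pt (\<epsilon> + \<tau> / 2) (pi / (2 * real N))"

| "rep_node Type_D \<epsilon> \<tau> N V1 = polar_pt \<epsilon> 0"
| "rep_node Type_D \<epsilon> \<tau> N V2 = polar_pt \<epsilon> (- pi / real N)"
| "rep_node Type_D \<epsilon> \<tau> N V3 = polar_pt (\<epsilon> + \<tau>) 0"
| "rep_node Type_D \<epsilon> \<tau> N M12 = polar_pt \<epsilon> (- pi / (2 * real N))"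
| "rep_node Type_D \<epsilon> \<tau> N M13 = polar_pt (\<epsilon> + \<tau> / 2) 0"
| "rep_node Type_D \<epsilon> \<tau> N M23 = polar_pt (\<epsilon> + \<tau> / 2) (- pi / (2 * real N))"

definition elem_map :: "element_type \<Rightarrow> real \<Rightarrow> real \<Rightarrow> nat \<Rightarrow> real^2 \<Rightarrow> real^2" where
  "elem_map k \<epsilon> \<tau> N = quad_map (rep_node k \<epsilon> \<tau> N)"

definition elem_jac :: "element_type \<Rightarrow> real \<Rightarrow> real \<Rightarrow> nat \<Rightarrow> real^2 \<Rightarrow> real" where
  "elem_jac k \<epsilon> \<tau> N y = det (jacobian (elem_map k \<epsilon> \<tau> N) (at y))"

text \<open>
  Both Jacobians with respect to the physical variable are taken within the set on which the function
  is defined: the closed curved element for the interpolant (whose points include edges and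
  vertices), the punctured closed disc for the cavity map (so that \<open>norm x = 1\<close> is covered).
\<close>

definition jac_error :: "(real \<Rightarrow> real) \<Rightarrow> element_type \<Rightarrow> real \<Rightarrow> real \<Rightarrow> nat \<Rightarrow> real^2 \<Rightarrow> real" where
  "jac_error r k \<epsilon> \<tau> N y =
     det (jacobian (iso_interp (cavity_map r) (rep_node k \<epsilon> \<tau> N))
            (at (elem_map k \<epsilon> \<tau> N y) within elem_map k \<epsilon> \<tau> N ` ref_triangle))
     - det (jacobian (cavity_map r) (at (elem_map k \<epsilon> \<tau> N y) within punctured_disc))"

text \<open>
  The conditions under which every quantity in the estimate makes sense at the reference point \<open>y\<close>:
  \<open>F_T\<close> parametrises the element, so that the interpolant is a function on it; the cavity map is
  defined at \<open>F_T y\<close>; and \<open>det \<nabla>x\<close>, by which the estimate divides, does not vanish there.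
\<close>

definition well_posed_at :: "element_type \<Rightarrow> real \<Rightarrow> real \<Rightarrow> nat \<Rightarrow> real^2 \<Rightarrow> bool" where
  "well_posed_at k \<epsilon> \<tau> N y \<longleftrightarrow>
     y \<in> ref_triangle \<and>
     inj_on (elem_map k \<epsilon> \<tau> N) ref_triangle \<and>
     elem_map k \<epsilon> \<tau> N y \<in> punctured_disc \<and>
     elem_jac k \<epsilon> \<tau> N y \<noteq> 0"

text \<open>
  For types A and B, \<open>det \<nabla>x\<close> vanishes somewhere on the reference triangle when \<open>\<tau>\<close> reaches a
  certain multiple of \<open>\<epsilon> N\<^sup>-\<^sup>4\<close>, and just above this value it is arbitrarily small compared
  with \<open>\<epsilon> \<tau> N\<^sup>-\<^sup>1\<close>, so that no bound uniform in the parameters can hold there. The condition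
  keeps \<open>\<tau>\<close> above a multiple \<open>K\<close> of \<open>\<epsilon> N\<^sup>-\<^sup>4\<close>. It holds automatically
  wherever \<open>N\<^sup>-\<^sup>4 / (\<epsilon> \<tau>) \<le> 1 / K\<close>
  (recall \<open>\<epsilon> \<le> 1\<close>). Types C and D are
  never close to degenerate and are not restricted.
\<close>

definition resolved :: "real \<Rightarrow> element_type \<Rightarrow> real \<Rightarrow> real \<Rightarrow> nat \<Rightarrow> bool" where
  "resolved K k \<epsilon> \<tau> N \<longleftrightarrow> (k \<in> {Type_A, Type_B} \<longrightarrow> K * \<epsilon> \<le> \<tau> * real N ^ 4)"

end

theory Submission
  imports Defs
begin

text \<open>
  Write \<open>F\<close> for the quadratic map of the element and \<open>G\<close> for the quadratic map whose nodes are the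
  images of the nodes of the element under the cavity map. The interpolant is \<open>G \<circ> F\<^sup>-\<^sup>1\<close>, so its
  Jacobian determinant is \<open>det DG / det DF\<close>, while the cavity map has the Jacobian determinant
  \<open>f R = r R * r' R / R\<close> at radius \<open>R\<close>. The error is therefore \<open>(det DG - f R * det DF) / det DF\<close>
  with \<open>R = \<bar>F y\<bar>\<close>, and two things are needed: an upper bound for the numerator and a lower bound for
  \<open>\<bar>det DF\<bar>\<close>.

  The cavity map moves points along rays. Hence \<open>G\<close> is a map of the same kind as \<open>F\<close>: only the
  three nodal radii \<open>t\<^sub>i\<close> change, to \<open>r t\<^sub>i\<close>. One explicit formula for the Jacobian in terms of nodal
  radii \<open>A, B, C\<close> thus serves both maps (\<open>quad_jac_wedge\<close> for types A and B, \<open>quad_jac_strip\<close> for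
  types C and D). In it the radial coordinate enters through the quadratic interpolant of
  the profile, and the angle only through corrections of relative order \<open>N\<^sup>-\<^sup>2\<close>.
  With \<open>t\<close> the linearly interpolated radius at the reference point, Taylor expansion gives
  \<open>det DF = c * t\<close> and \<open>det DG = c * r t * r' t\<close> with the same factor \<open>c = O (\<tau> / N)\<close>, both up to the
  error \<open>\<tau>\<^sup>3 / N + (\<epsilon> + \<tau>) * \<tau> / N\<^sup>3 + 1 / N\<^sup>5\<close>. The small factor \<open>\<epsilon> + \<tau>\<close> appears for \<open>F\<close> because the
  radii are that small, and for \<open>G\<close> because the slope of \<open>r\<close> is, by \<open>r' R \<le> M * R\<close>.

  Since \<open>t * f t = r t * r' t\<close>, the leading terms of \<open>det DG - f R * det DF\<close> cancel except for
  \<open>c * (t * f t - t * f R)\<close>. The functions \<open>r * r'\<close> and \<open>f\<close> are respectively Lipschitz and bounded, and the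
  quadratic interpolation of a circular arc satisfies \<open>R - t = O ((\<epsilon> + \<tau>) / N\<^sup>2)\<close>, so this remainder
  is of the same order as the error already present (\<open>jacobian_defect_bound\<close>).

  For the lower bound, the same formulas with \<open>A, B, C\<close> equal to the radii themselves yield
  \<open>\<bar>det DF\<bar> \<ge> \<epsilon> * \<tau> / N\<close>: always for types C and D, and for types A and B as soon as
  \<open>N \<ge> 2\<close>, which injectivity of \<open>F\<close> forces, and \<open>\<tau>\<close> dominates \<open>\<epsilon> / N\<^sup>4\<close>. Dividing the first estimate
  by this bound gives the second one.
\<close>


section \<open>Jacobians on sets with boundary\<close>

text \<open>
  The derivative within a set with boundary is determined by its values on velocities of curves that
  stay in the set; if these span the space, the derivative is unique. This covers the corners of a
  curved triangle and the outer circle of the disc, where no neighbourhood in the set is available.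
\<close>

lemma frechet_derivative_eq_of_curves:
  fixes f :: "'a::euclidean_space \<Rightarrow> 'b::real_normed_vector"
  assumes f': "(f has_derivative f') (at x within S)"
    and V: "span V = UNIV"
    and curves: "\<And>v. v \<in> V \<Longrightarrow>
      \<exists>\<gamma>. \<gamma> 0 = x \<and> \<gamma> ` {0..1::real} \<subseteq> S \<and> (\<gamma> has_vector_derivative v) (at 0 within {0..1})"
  shows "frechet_derivative f (at x within S) = f'"
proof -
  let ?D = "frechet_derivative f (at x within S)"
  have D: "(f has_derivative ?D) (at x within S)"
    using f' frechet_derivative_works differentiable_def by blast
  have "?D v = f' v" if v: "v \<in> V" for v
  proof -
    obtain \<gamma> where g0: "\<gamma> 0 = x" and im: "\<gamma> ` {0..1::real} \<subseteq> S"
      and g: "(\<gamma> has_vector_derivative v) (at 0 within {0..1})"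
      using curves[OF v] by blast
    have comp: "((f \<circ> \<gamma>) has_vector_derivative d v) (at 0 within {0..1})"
      if d: "(f has_derivative d) (at x within S)" for d
    proof -
      have "(f has_derivative d) (at (\<gamma> 0) within \<gamma> ` {0..1})"
        using d im by (simp add: g0 has_derivative_subset)
      then show ?thesis
        using vector_derivative_diff_chain_within[OF g] by blast
    qed
    show ?thesis
      using vector_derivative_unique_within_closed_interval[of 0 1 0 "f \<circ> \<gamma>" "?D v" "f' v"]
        comp[OF D] comp[OF f'] by simp
  qed
  moreover have "linear ?D" "linear f'"
    using D f' has_derivative_linear by blast+
  ultimately have "?D v = f' v" for v
    using linear_eq_on_span[of ?D f' V v] V by auto
  then show ?thesis by blast
qed

lemma ref_triangle_convex_hull: "ref_triangle = convex hull {0, axis 1 1, axis 2 1}"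
proof -
  have "x \<in> ref_triangle \<longleftrightarrow> x \<in> convex hull {0, axis 1 1, axis 2 1}" for x :: "real^2"
  proof
    assume "x \<in> ref_triangle"
    then have "x = (1 - x$1 - x$2) *\<^sub>R 0 + x$1 *\<^sub>R axis 1 1 + x$2 *\<^sub>R axis 2 1"
      "0 \<le> 1 - x$1 - x$2" "0 \<le> x$1" "0 \<le> x$2"
      by (auto simp: ref_triangle_def vec_eq_iff forall_2 axis_def)
    then show "x \<in> convex hull {0, axis 1 1, axis 2 1}"
      unfolding convex_hull_3
      by (intro CollectI exI[of _ "1 - x$1 - x$2"] exI[of _ "x$1"] exI[of _ "x$2"]) auto
  next
    assume "x \<in> convex hull {0, axis 1 1, axis 2 1}"
    then show "x \<in> ref_triangle"
      by (auto simp: convex_hull_3 ref_triangle_def axis_def)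
  qed
  then show ?thesis by blast
qed

lemma compact_ref_triangle: "compact ref_triangle"
  and convex_ref_triangle: "convex ref_triangle"
  unfolding ref_triangle_convex_hull by (auto intro: compact_convex_hull)

text \<open>
  Segments from \<open>y\<close> to points of the triangle stay in the triangle, so these differences are
  admissible velocities; they span the plane even when \<open>y\<close> is a vertex.
\<close>

lemma span_ref_triangle_directions: "span ((\<lambda>z. z - y) ` ref_triangle) = UNIV"
proof -
  let ?W = "(\<lambda>z. z - y) ` ref_triangle"
  have axis_in: "axis i 1 \<in> span ?W" for i :: 2
  proof -
    have "axis i 1 \<in> ref_triangle" "0 \<in> ref_triangle"
      using exhaust_2[of i] by (auto simp: ref_triangle_def axis_def)
    then have "axis i 1 - y \<in> span ?W" "0 - y \<in> span ?W"
      by (auto intro!: span_base)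
    then have "(axis i 1 - y) - (0 - y) \<in> span ?W"
      by (rule span_diff)
    then show ?thesis by simp
  qed
  have "x \<in> span ?W" for x
  proof -
    have "x = x$1 *\<^sub>R axis 1 1 + x$2 *\<^sub>R axis 2 1"
      by (simp add: vec_eq_iff forall_2 axis_def)
    then show ?thesis
      using axis_in by (metis span_add span_scale)
  qed
  then show ?thesis by blast
qed

text \<open>
  The chain rule on the closed element. The inverse of \<open>F\<close> is continuous by compactness of the
  triangle, hence differentiable wherever \<open>F\<close> has an invertible derivative, and images under \<open>F\<close> of
  segments in the triangle supply the curves that make the derivative unique.
\<close>

lemma det_jacobian_composed_with_inverse:
  fixes F G :: "real^2 \<Rightarrow> real^2"
  assumes F: "\<And>x. (F has_derivative F' x) (at x)"
    and G: "(G has_derivative G') (at y)"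
    and inj: "inj_on F ref_triangle" and y: "y \<in> ref_triangle"
    and det: "det (matrix (F' y)) \<noteq> 0"
  shows "det (jacobian (\<lambda>x. G (inv_into ref_triangle F x)) (at (F y) within F ` ref_triangle))
           = det (matrix G') / det (matrix (F' y))"
proof -
  let ?T = ref_triangle
  let ?I = "inv_into ?T F"
  let ?L = "F' y"
  have lin: "linear ?L"
    using F has_derivative_linear by blast
  have "invertible (matrix ?L)"
    using det by (simp add: invertible_det_nz)
  then obtain K where K: "linear K" "K \<circ> ?L = id" "?L \<circ> K = id"
    using lin by (metis matrix_invertible)
  have cont: "continuous_on (F ` ?T) ?I"
  proof (rule continuous_on_inv)
    show "continuous_on ?T F"
      using F by (meson continuous_at_imp_continuous_on has_derivative_continuous)
  qed (use inj compact_ref_triangle in auto)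
  have inv: "(?I has_derivative K) (at (F y) within F ` ?T)"
    by (rule has_derivative_inverse_within[of F ?L])
      (use F[of y] y K inj cont in \<open>auto simp: has_derivative_at_withinI continuous_on_eq_continuous_within\<close>)
  have Iy: "?I (F y) = y" using inj y by simp
  have comp: "((\<lambda>x. G (?I x)) has_derivative (\<lambda>h. G' (K h))) (at (F y) within F ` ?T)"
    using has_derivative_compose[OF inv, of G G'] G Iy by simp
  have "frechet_derivative (\<lambda>x. G (?I x)) (at (F y) within F ` ?T) = (\<lambda>h. G' (K h))"
  proof (rule frechet_derivative_eq_of_curves[OF comp, where V = "?L ` (\<lambda>z. z - y) ` ?T"])
    have "surj ?L"
      using K(3) by (metis comp_apply id_apply surjI)
    then show "span (?L ` (\<lambda>z. z - y) ` ?T) = UNIV"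
      by (simp add: linear_span_image[OF lin] span_ref_triangle_directions)
  next
    fix v assume "v \<in> ?L ` (\<lambda>z. z - y) ` ?T"
    then obtain z where z: "z \<in> ?T" and v: "v = ?L (z - y)" by blast
    let ?\<gamma> = "\<lambda>t::real. F (y + t *\<^sub>R (z - y))"
    have "y + t *\<^sub>R (z - y) \<in> ?T" if "t \<in> {0..1}" for t
    proof -
      have "y + t *\<^sub>R (z - y) = (1 - t) *\<^sub>R y + t *\<^sub>R z" by (simp add: algebra_simps)
      then show ?thesis
        using convexD_alt[OF convex_ref_triangle y z, of t] that by simp
    qed
    then have "?\<gamma> ` {0..1} \<subseteq> F ` ?T" by blast
    moreover have "(?\<gamma> has_vector_derivative v) (at 0 within {0..1})"
      unfolding has_vector_derivative_def v
      by (rule has_derivative_eq_rhs, rule has_derivative_compose[where g = F and g' = ?L])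
        (use F[of y] in \<open>auto intro!: derivative_eq_intros simp: linear_scale[OF lin]\<close>)
    ultimately show "\<exists>\<gamma>. \<gamma> 0 = F y \<and> \<gamma> ` {0..1::real} \<subseteq> F ` ?T \<and>
        (\<gamma> has_vector_derivative v) (at 0 within {0..1})"
      by (intro exI[of _ ?\<gamma>]) simp
  qed
  moreover have "det (matrix (\<lambda>h. G' (K h))) = det (matrix G') * det (matrix K)"
    using G K(1) by (simp add: matrix_compose[unfolded o_def] det_mul has_derivative_linear)
  moreover have "det (matrix K) * det (matrix ?L) = 1"
    by (metis K(1,2) det_I det_mul lin matrix_compose matrix_id)
  ultimately show ?thesis
    using det by (simp add: jacobian_def field_simps)
qed

text \<open>
  A radial map stretches by \<open>r'\<close> along the ray and by \<open>r R / R\<close> across it. A shrinking segment of the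
  ray and a rotation stay in the disc even from a point on its boundary circle, and their velocities
  span the plane.
\<close>

lemma det_jacobian_radial_map:
  assumes r: "(r has_real_derivative r') (at (norm x) within {0<..1})"
    and x: "x \<in> punctured_disc"
  shows "det (jacobian (cavity_map r) (at x within punctured_disc)) = r (norm x) * r' / norm x"
proof -
  let ?R = "norm x"
  define \<phi>' where "\<phi>' = (r' * ?R - r ?R) / ?R\<^sup>2"
  have R: "0 < ?R" "?R \<le> 1" and x0: "x \<noteq> 0"
    using x by (auto simp: punctured_disc_def)
  have "((\<lambda>R. r R / R) has_real_derivative \<phi>') (at ?R within {0<..1})"
    unfolding \<phi>'_def by (rule derivative_eq_intros r refl | use R in \<open>simp add: power2_eq_square\<close>)+
  then have phi: "((\<lambda>R. r R / R) has_derivative (*) \<phi>') (at ?R within norm ` punctured_disc)"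
    unfolding has_field_derivative_def
    by (rule has_derivative_subset) (auto simp: punctured_disc_def)
  have nrm: "(norm has_derivative (\<lambda>h. inner x h / ?R)) (at x within punctured_disc)"
    using has_derivative_at_withinI[OF has_derivative_norm[OF x0]]
    by (simp add: sgn_div_norm inner_commute divide_inverse mult.commute)
  have der: "(cavity_map r has_derivative (\<lambda>h. (r ?R / ?R) *\<^sub>R h + (\<phi>' * (inner x h / ?R)) *\<^sub>R x))
      (at x within punctured_disc)"
    unfolding cavity_map_def
    by (rule has_derivative_eq_rhs,
        rule has_derivative_scaleR[OF diff_chain_within[OF nrm phi, unfolded o_def] has_derivative_ident]) simp
  define w :: "real^2" where "w = vector [- (x$2), x$1]"
  have fd: "frechet_derivative (cavity_map r) (at x within punctured_disc)
      = (\<lambda>h. (r ?R / ?R) *\<^sub>R h + (\<phi>' * (inner x h / ?R)) *\<^sub>R x)"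
  proof (rule frechet_derivative_eq_of_curves[OF der, where V = "{- (1/2) *\<^sub>R x, w}"])
    have n2: "x$1 * x$1 + x$2 * x$2 \<noteq> 0"
      using x0 by (auto simp: vec_eq_iff forall_2 sum_squares_eq_zero_iff)
    have "h \<in> span {- (1/2) *\<^sub>R x, w}" for h
    proof -
      \<comment> \<open>coordinates of \<open>h\<close> in the orthogonal frame \<open>x, w\<close>\<close>
      define p q where "p = (h$1 * x$1 + h$2 * x$2) / (x$1 * x$1 + x$2 * x$2)"
        and "q = (h$2 * x$1 - h$1 * x$2) / (x$1 * x$1 + x$2 * x$2)"
      have "h$1 = p * x$1 - q * x$2" "h$2 = p * x$2 + q * x$1"
        unfolding p_def q_def times_divide_eq_left
          add_divide_distrib[symmetric] diff_divide_distrib[symmetric] nonzero_eq_divide_eq[OF n2]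
        by (simp_all add: algebra_simps)
      then have "h = (- 2 * p) *\<^sub>R (- (1/2) *\<^sub>R x) + q *\<^sub>R w"
        by (simp add: vec_eq_iff forall_2 w_def)
      then show ?thesis
        by (metis insertI1 insertI2 span_add span_base span_scale)
    qed
    then show "span {- (1/2) *\<^sub>R x, w} = UNIV" by blast
  next
    fix v assume "v \<in> {- (1/2) *\<^sub>R x, w}"
    then consider "v = - (1/2) *\<^sub>R x" | "v = w" by blast
    then show "\<exists>\<gamma>. \<gamma> 0 = x \<and> \<gamma> ` {0..1::real} \<subseteq> punctured_disc \<and>
        (\<gamma> has_vector_derivative v) (at 0 within {0..1})"
    proof cases
      case 1
      let ?\<gamma> = "\<lambda>t::real. (1 - t/2) *\<^sub>R x"
      have "(?\<gamma> has_vector_derivative v) (at 0 within {0..1})"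
        unfolding 1 by (auto intro!: derivative_eq_intros simp: has_vector_derivative_def)
      moreover have "?\<gamma> ` {0..1} \<subseteq> punctured_disc"
        using R by (auto simp: punctured_disc_def intro!: mult_le_one)
      ultimately show ?thesis by (intro exI[of _ ?\<gamma>]) simp
    next
      case 2
      let ?\<gamma> = "\<lambda>t::real. cos t *\<^sub>R x + sin t *\<^sub>R w"
      have "norm (?\<gamma> t) = norm x" for t
      proof -
        have "(cos t * x$1 - sin t * x$2)\<^sup>2 + (cos t * x$2 + sin t * x$1)\<^sup>2
            = ((sin t)\<^sup>2 + (cos t)\<^sup>2) * ((x$1)\<^sup>2 + (x$2)\<^sup>2)"
          by algebra
        then show ?thesis
          by (simp add: norm_vec_def L2_set_def sum_2 w_def)
      qed
      then have "?\<gamma> ` {0..1} \<subseteq> punctured_disc"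
        using R by (auto simp: punctured_disc_def simp del: zero_less_norm_iff)
      moreover have "(?\<gamma> has_vector_derivative v) (at 0 within {0..1})"
        unfolding 2 by (auto intro!: derivative_eq_intros simp: has_vector_derivative_def)
      ultimately show ?thesis by (intro exI[of _ ?\<gamma>]) simp
    qed
  qed
  have R2: "?R * ?R = x$1 * x$1 + x$2 * x$2"
    by (simp add: norm_vec_def L2_set_def sum_2 power2_eq_square)
  have "det (jacobian (cavity_map r) (at x within punctured_disc))
      = (r ?R / ?R)\<^sup>2 + (r ?R / ?R) * (\<phi>' / ?R) * (x$1 * x$1 + x$2 * x$2)"
    unfolding jacobian_def fd
    by (simp add: det_2 matrix_def axis_def inner_vec_def sum_2 power2_eq_square algebra_simps)
  also have "\<dots> = r ?R * r' / ?R"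
    unfolding R2[symmetric] \<phi>'_def using R by (simp add: field_simps power2_eq_square)
  finally show ?thesis .
qed

section \<open>Quadratic maps with nodes in polar position\<close>

fun shape_grad :: "node \<Rightarrow> real^2 \<Rightarrow> real^2" where
  "shape_grad V1 y = vector [1 - 4 * bary1 y, 1 - 4 * bary1 y]"
| "shape_grad V2 y = vector [4 * bary2 y - 1, 0]"
| "shape_grad V3 y = vector [0, 4 * bary3 y - 1]"
| "shape_grad M12 y = vector [4 * (bary1 y - bary2 y), - 4 * bary2 y]"
| "shape_grad M13 y = vector [- 4 * bary3 y, 4 * (bary1 y - bary3 y)]"
| "shape_grad M23 y = vector [4 * bary3 y, 4 * bary2 y]"

lemma has_derivative_shape_fun:
  "(shape_fun n has_derivative (\<lambda>h. inner (shape_grad n y) h)) (at y)"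
proof -
  note [derivative_intros] = bounded_linear.has_derivative[OF bounded_linear_vec_nth]
  have "shape_fun V1 = (\<lambda>x. (1 - x$1 - x$2) * (2 * (1 - x$1 - x$2) - 1))"
    "shape_fun V2 = (\<lambda>x. x$1 * (2 * x$1 - 1))"
    "shape_fun V3 = (\<lambda>x. x$2 * (2 * x$2 - 1))"
    "shape_fun M12 = (\<lambda>x. 4 * (1 - x$1 - x$2) * x$1)"
    "shape_fun M13 = (\<lambda>x. 4 * (1 - x$1 - x$2) * x$2)"
    "shape_fun M23 = (\<lambda>x. 4 * x$1 * x$2)"
    by (auto simp: bary1_def bary2_def bary3_def)
  note eqs = this
  have "(shape_fun n has_derivative (\<lambda>h. shape_grad n y $ 1 * h$1 + shape_grad n y $ 2 * h$2)) (at y)"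
    by (cases n; hypsubst; unfold eqs; rule has_derivative_eq_rhs, (rule derivative_intros)+)
      (auto simp: bary1_def bary2_def bary3_def fun_eq_iff algebra_simps)
  then show ?thesis
    by (simp add: inner_vec_def sum_2)
qed

definition quad_deriv :: "(node \<Rightarrow> real^2) \<Rightarrow> real^2 \<Rightarrow> real^2 \<Rightarrow> real^2" where
  "quad_deriv a y h = (\<Sum>n\<in>{V1, V2, V3, M12, M13, M23}. inner (shape_grad n y) h *\<^sub>R a n)"

definition quad_jac :: "(node \<Rightarrow> real^2) \<Rightarrow> real^2 \<Rightarrow> real" where
  "quad_jac a y = det (matrix (quad_deriv a y))"

lemma has_derivative_quad_map: "(quad_map a has_derivative quad_deriv a y) (at y)"
proof -
  have "((\<lambda>x. quad_map a x) has_derivative (\<lambda>h. quad_deriv a y h)) (at y)"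
    unfolding quad_map_def quad_deriv_def
    by (intro has_derivative_sum has_derivative_scaleR_left has_derivative_shape_fun)
  then show ?thesis by simp
qed

lemma elem_jac_eq_quad_jac: "elem_jac k \<epsilon> \<tau> N y = quad_jac (rep_node k \<epsilon> \<tau> N) y"
  unfolding elem_jac_def elem_map_def quad_jac_def jacobian_def
  using frechet_derivative_at[OF has_derivative_quad_map] by metis

text \<open>
  The relabelling of the nodes induced by the reflection of the reference triangle that exchanges its
  last two vertices.
\<close>

definition node_swap :: "node \<Rightarrow> node" where
  "node_swap n = (case n of V1 \<Rightarrow> V1 | V2 \<Rightarrow> V3 | V3 \<Rightarrow> V2 | M12 \<Rightarrow> M13 | M13 \<Rightarrow> M12 | M23 \<Rightarrow> M23)"

lemmas quad_expand = quad_map_def quad_jac_def quad_deriv_def node_swap_def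
  bary1_def bary2_def bary3_def det_2 matrix_def axis_def inner_vec_def sum_2 vec_eq_iff forall_2

lemma quad_map_swap: "quad_map (a \<circ> node_swap) y = quad_map a (vector [y$2, y$1])"
  by (simp add: quad_expand algebra_simps)

lemma quad_jac_swap: "quad_jac (a \<circ> node_swap) y = - quad_jac a (vector [y$2, y$1])"
  by (simp add: quad_expand algebra_simps)

text \<open>
  The node layout of types A and B: one vertex on the middle ray at radius \<open>A\<close>, the other two and their
  common midpoint on the circle of radius \<open>C\<close>. Angles are multiples of \<open>\<beta> = \<plusminus>\<pi> / (4 N)\<close>, which
  keeps the half angle formulas polynomial in \<open>sin \<beta>\<close> and \<open>sin (2 * \<beta>)\<close>; the sign of \<open>\<beta>\<close> accounts for
  the two orientations.
\<close>

definition wedge_nodes :: "real \<Rightarrow> real \<Rightarrow> real \<Rightarrow> real \<Rightarrow> (node \<Rightarrow> real^2) \<Rightarrow> bool" where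
  "wedge_nodes A B C \<beta> a \<longleftrightarrow>
     a V1 = polar_pt A 0 \<and> a V2 = polar_pt C (- 4 * \<beta>) \<and> a V3 = polar_pt C (4 * \<beta>) \<and>
     a M12 = polar_pt B (- 2 * \<beta>) \<and> a M13 = polar_pt B (2 * \<beta>) \<and> a M23 = polar_pt C 0"

text \<open>
  The node layout of types C and, after exchanging the last two vertices, D: two vertices and their
  midpoint on the circle of radius \<open>A\<close>, the third vertex at radius \<open>C\<close> on the ray of the first.
\<close>

definition strip_nodes :: "real \<Rightarrow> real \<Rightarrow> real \<Rightarrow> real \<Rightarrow> (node \<Rightarrow> real^2) \<Rightarrow> bool" where
  "strip_nodes A B C \<beta> a \<longleftrightarrow>
     a V1 = polar_pt A 0 \<and> a V2 = polar_pt C 0 \<and> a V3 = polar_pt A (4 * \<beta>) \<and>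
     a M12 = polar_pt B 0 \<and> a M13 = polar_pt A (2 * \<beta>) \<and> a M23 = polar_pt B (2 * \<beta>)"

lemma cavity_map_polar_pt: "0 < t \<Longrightarrow> cavity_map r (polar_pt t \<alpha>) = polar_pt (r t) \<alpha>"
proof -
  assume t: "0 < t"
  have "(t * cos \<alpha>)\<^sup>2 + (t * sin \<alpha>)\<^sup>2 = t\<^sup>2"
    by (simp add: power_mult_distrib flip: distrib_left)
  then have "norm (polar_pt t \<alpha>) = t"
    using t by (simp add: norm_vec_def L2_set_def sum_2 polar_pt_def)
  then show ?thesis
    using t by (simp add: cavity_map_def polar_pt_def vec_eq_iff forall_2)
qed

lemma wedge_nodes_cavity_map:
  assumes "wedge_nodes A B C \<beta> a" "0 < A" "0 < B" "0 < C"
  shows "wedge_nodes (r A) (r B) (r C) \<beta> (cavity_map r \<circ> a)"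
  using assms by (simp add: wedge_nodes_def cavity_map_polar_pt)

lemma strip_nodes_cavity_map:
  assumes "strip_nodes A B C \<beta> a" "0 < A" "0 < B" "0 < C"
  shows "strip_nodes (r A) (r B) (r C) \<beta> (cavity_map r \<circ> a)"
  using assms by (simp add: strip_nodes_def cavity_map_polar_pt)

lemma rep_node_wedge_or_strip:
  shows "wedge_nodes \<epsilon> (\<epsilon> + \<tau> / 2) (\<epsilon> + \<tau>) (pi / (4 * real N)) (rep_node Type_A \<epsilon> \<tau> N)"
    and "wedge_nodes (\<epsilon> + \<tau>) (\<epsilon> + \<tau> / 2) \<epsilon> (- pi / (4 * real N)) (rep_node Type_B \<epsilon> \<tau> N)"
    and "strip_nodes \<epsilon> (\<epsilon> + \<tau> / 2) (\<epsilon> + \<tau>) (pi / (4 * real N)) (rep_node Type_C \<epsilon> \<tau> N)"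
    and "strip_nodes \<epsilon> (\<epsilon> + \<tau> / 2) (\<epsilon> + \<tau>) (- pi / (4 * real N))
           (rep_node Type_D \<epsilon> \<tau> N \<circ> node_swap)"
  by (simp_all add: wedge_nodes_def strip_nodes_def node_swap_def)

text \<open>
  All angles of an element are expressed by \<open>\<eta> = sin \<beta>\<close> and \<open>\<sigma> = sin (2 * \<beta>)\<close>, so that the
  formulas for its map and its Jacobian become polynomial identities.
\<close>

lemma trig_quarter_angle:
  fixes \<beta> :: real
  shows "cos (4 * \<beta>) = 1 - 8 * (sin \<beta>)\<^sup>2 * (1 - (sin \<beta>)\<^sup>2)"
    and "sin (4 * \<beta>) = 2 * sin (2 * \<beta>) * (1 - 2 * (sin \<beta>)\<^sup>2)"
    and "cos (2 * \<beta>) = 1 - 2 * (sin \<beta>)\<^sup>2"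
    and "(sin (2 * \<beta>))\<^sup>2 = 4 * (sin \<beta>)\<^sup>2 * (1 - (sin \<beta>)\<^sup>2)"
proof -
  show c2: "cos (2 * \<beta>) = 1 - 2 * (sin \<beta>)\<^sup>2"
    by (rule cos_double_sin)
  show s2: "(sin (2 * \<beta>))\<^sup>2 = 4 * (sin \<beta>)\<^sup>2 * (1 - (sin \<beta>)\<^sup>2)"
    by (simp add: sin_double power_mult_distrib cos_squared_eq)
  show "sin (4 * \<beta>) = 2 * sin (2 * \<beta>) * (1 - 2 * (sin \<beta>)\<^sup>2)"
    using sin_double[of "2 * \<beta>"] by (simp add: c2)
  show "cos (4 * \<beta>) = 1 - 8 * (sin \<beta>)\<^sup>2 * (1 - (sin \<beta>)\<^sup>2)"
    using cos_double_sin[of "2 * \<beta>"] s2 by simp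
qed

text \<open>
  The derivative at \<open>s\<close> of the quadratic polynomial with the values \<open>A, B, C\<close> at \<open>0, 1/2, 1\<close>.
\<close>

definition interp_slope :: "real \<Rightarrow> real \<Rightarrow> real \<Rightarrow> real \<Rightarrow> real" where
  "interp_slope A B C s = (4 * s - 3) * A + 4 * (1 - 2 * s) * B + (4 * s - 1) * C"

text \<open>
  In the coordinates \<open>s\<close> (towards the arc) and \<open>d\<close> (along it) the first component is the quadratic
  interpolant of the radii in \<open>s\<close> plus terms of order \<open>\<eta>\<^sup>2\<close>, and the second is \<open>2 * \<sigma> * d\<close> times a
  radius.
\<close>

lemma quad_map_wedge:
  fixes y :: "real^2"
  assumes "wedge_nodes A B C \<beta> a"
  defines "s \<equiv> y$1 + y$2" and "d \<equiv> y$2 - y$1" and "\<eta>2 \<equiv> (sin \<beta>)\<^sup>2" and "\<sigma> \<equiv> sin (2 * \<beta>)"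
  shows "quad_map a y $ 1 = (1 - s) * (1 - 2 * s) * A + 4 * s * (1 - s) * B + s * (2 * s - 1) * C
           - 8 * B * \<eta>2 * s * (1 - s) + 8 * C * \<eta>2 * (1 - \<eta>2) * (s - s\<^sup>2 - d\<^sup>2)"
    and "quad_map a y $ 2 = 2 * \<sigma> * d * (B * (2 - 2 * s) + C * (2 * s - 1) - 2 * C * \<eta>2 * (2 * s - 1))"
  using assms(1) unfolding s_def d_def
  by (simp_all add: wedge_nodes_def polar_pt_def quad_expand trig_quarter_angle(1,2,3)
      flip: \<eta>2_def \<sigma>_def) (simp_all add: algebra_simps power2_eq_square)

text \<open>
  Up to the common factor \<open>2 * \<sigma>\<close>, the first factor is the derivative of the first component in \<open>s\<close>,
  the second that of the second component in \<open>d\<close>, and the last summand comes from the product of the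
  mixed derivatives. The change of coordinates to \<open>s\<close> and \<open>d\<close> contributes another factor \<open>2\<close>.
\<close>

lemma quad_jac_wedge:
  fixes y :: "real^2"
  assumes "wedge_nodes A B C \<beta> a"
  defines "s \<equiv> y$1 + y$2" and "d \<equiv> y$2 - y$1" and "\<eta>2 \<equiv> (sin \<beta>)\<^sup>2" and "\<sigma> \<equiv> sin (2 * \<beta>)"
  shows "quad_jac a y = 4 * \<sigma> *
    ((interp_slope A B C s + 8 * \<eta>2 * (1 - 2 * s) * (C - B - C * \<eta>2))
       * (B * (2 - 2 * s) + C * (2 * s - 1) - 2 * C * \<eta>2 * (2 * s - 1))
     + 32 * \<eta>2 * (1 - \<eta>2) * C * d\<^sup>2 * (C - B - 2 * C * \<eta>2))"
  using assms(1) unfolding s_def d_def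
  by (simp add: wedge_nodes_def polar_pt_def quad_expand trig_quarter_angle(1,2,3) interp_slope_def
      flip: \<eta>2_def \<sigma>_def) (simp add: algebra_simps power2_eq_square)

lemma quad_map_strip:
  fixes y :: "real^2"
  assumes "strip_nodes A B C \<beta> a"
  defines "x \<equiv> y$1" and "b \<equiv> y$2" and "\<eta>2 \<equiv> (sin \<beta>)\<^sup>2" and "\<sigma> \<equiv> sin (2 * \<beta>)"
  shows "quad_map a y $ 1 = (1 - x) * (1 - 2 * x) * A + 4 * x * (1 - x) * B + x * (2 * x - 1) * C
           - 8 * \<eta>2 * b * (A * b + (B - A) * x - A * \<eta>2 * (2 * b - 1))"
    and "quad_map a y $ 2 = 2 * \<sigma> * b * (A * (1 - 2 * x) + B * (2 * x) - 2 * A * \<eta>2 * (2 * b - 1))"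
  using assms(1) unfolding x_def b_def
  by (simp_all add: strip_nodes_def polar_pt_def quad_expand trig_quarter_angle(1,2,3)
      flip: \<eta>2_def \<sigma>_def) (simp_all add: algebra_simps power2_eq_square)

text \<open>
  The same structure as for a wedge: slope times radius, plus the product of the mixed derivatives.
\<close>

lemma quad_jac_strip:
  fixes y :: "real^2"
  assumes "strip_nodes A B C \<beta> a"
  defines "x \<equiv> y$1" and "b \<equiv> y$2" and "\<eta>2 \<equiv> (sin \<beta>)\<^sup>2" and "\<sigma> \<equiv> sin (2 * \<beta>)"
  shows "quad_jac a y = 2 * \<sigma> *
    ((interp_slope A B C x - 8 * \<eta>2 * b * (B - A))
       * (A * (1 - 2 * x) + B * (2 * x) - 2 * A * \<eta>2 * (4 * b - 1))
     + 16 * \<eta>2 * b * (B - A) * (2 * A * b + (B - A) * x - A * \<eta>2 * (4 * b - 1)))"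
  using assms(1) unfolding x_def b_def
  by (simp add: strip_nodes_def polar_pt_def quad_expand trig_quarter_angle(1,2,3) interp_slope_def
      flip: \<eta>2_def \<sigma>_def) (simp add: algebra_simps power2_eq_square)

section \<open>Perturbation of a product of slope and radius\<close>

text \<open>
  The numerator of the estimate, with \<open>z\<close> for \<open>\<epsilon> + \<tau>\<close>, \<open>\<delta>\<close> for \<open>\<tau>\<close> and \<open>n\<close> for \<open>1 / N\<close>.
\<close>

definition error_scale :: "real \<Rightarrow> real \<Rightarrow> real \<Rightarrow> real" where
  "error_scale z \<delta> n = \<delta>^3 * n + z * \<delta> * n^3 + n^5"

text \<open>
  The Jacobian of an element has the form \<open>\<sigma> * (X * Y + Z)\<close> with \<open>X\<close> close to a slope \<open>w\<close>, \<open>Y\<close> close to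
  a radius \<open>v\<close> and \<open>Z\<close> small. Slopes are bounded by \<open>L * \<delta>\<close> and radii by \<open>S\<close>. The delicate
  terms are those of order \<open>S * L * \<delta> * n\<^sup>2\<close>, and they gain the factor \<open>z\<close> from \<open>S * L \<le> K * z\<close>;
  every other term is already dominated by \<open>\<delta>\<^sup>3\<close> or \<open>n\<^sup>4\<close> with \<open>S\<close> and \<open>L\<close> replaced by \<open>K\<close>.
\<close>

lemma slope_radius_product_estimate:
  fixes X w Y v Z \<delta> n z S L K :: real
  assumes X: "\<bar>X - w\<bar> \<le> K * \<delta>^3 + 8 * n\<^sup>2 * (L * \<delta> + S * n\<^sup>2)"
    and Y: "\<bar>Y - v\<bar> \<le> K * \<delta>\<^sup>2 + 6 * S * n\<^sup>2"
    and Z: "\<bar>Z\<bar> \<le> 128 * S * n\<^sup>2 * (L * \<delta> + S * n\<^sup>2)"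
    and w: "\<bar>w\<bar> \<le> L * \<delta>" and v: "\<bar>v\<bar> \<le> S"
    and bounds: "S \<le> K" "0 \<le> L" "L \<le> K" "S * L \<le> K * z" "1 \<le> K" "0 \<le> \<delta>" "\<delta> \<le> 1" "0 \<le> n" "n \<le> 1"
    and \<sigma>: "\<bar>\<sigma>\<bar> \<le> 8 * n"
  shows "\<bar>\<sigma> * (X * Y + Z) - \<sigma> * (w * v)\<bar> \<le> 3000 * K\<^sup>2 * error_scale z \<delta> n"
proof -
  define P Q W where "P = \<delta>^3" and "Q = z * \<delta> * n\<^sup>2" and "W = n^4"
  have S0: "0 \<le> S" using v by linarith
  have z0: "0 \<le> z"
  proof -
    have "0 \<le> K * z" using bounds S0 by (meson mult_nonneg_nonneg order_trans)
    then show ?thesis using bounds(5) by (simp add: zero_le_mult_iff)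
  qed
  have n2: "n\<^sup>2 \<le> 1" "0 \<le> n\<^sup>2" using bounds by (auto simp: power_le_one)
  have d2: "\<delta>\<^sup>2 \<le> 1" "0 \<le> \<delta>\<^sup>2" using bounds by (auto simp: power_le_one)
  have PQW: "0 \<le> P" "0 \<le> Q" "0 \<le> W" unfolding P_def Q_def W_def using bounds z0 by auto
  have KK: "K \<le> K\<^sup>2" using bounds(5) by (simp add: self_le_power)
  \<comment> \<open>products of the bounds, each reduced to one of the admissible orders \<open>P, Q, W\<close>\<close>
  have SL: "S * (L * \<delta>) * n\<^sup>2 \<le> K\<^sup>2 * Q"
  proof -
    have "S * L * (\<delta> * n\<^sup>2) \<le> K * z * (\<delta> * n\<^sup>2)"
      using bounds by (intro mult_right_mono) auto
    also have "\<dots> = K * Q" by (simp add: Q_def)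
    also have "\<dots> \<le> K\<^sup>2 * Q" using KK PQW by (intro mult_right_mono)
    finally show ?thesis by (simp add: mult_ac)
  qed
  have SS: "S * S * n^4 \<le> K\<^sup>2 * W"
    unfolding W_def power2_eq_square using bounds S0 by (intro mult_right_mono mult_mono) auto
  have LP: "L * \<delta> * (K * \<delta>\<^sup>2) \<le> K\<^sup>2 * P"
  proof -
    have "L * K * \<delta>^3 \<le> K * K * \<delta>^3"
      using bounds by (intro mult_right_mono) auto
    then show ?thesis by (simp add: P_def power2_eq_square power3_eq_cube mult_ac)
  qed
  let ?x = "K * \<delta>^3 + 8 * n\<^sup>2 * (L * \<delta> + S * n\<^sup>2)"
  have YK: "\<bar>Y - v\<bar> + S \<le> 8 * K"
  proof -
    have "K * \<delta>\<^sup>2 \<le> K" "S * n\<^sup>2 \<le> S"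
      using d2 n2 bounds S0 by (auto intro: mult_left_le)
    then show ?thesis using Y bounds by linarith
  qed
  have a1: "K * \<delta>^3 * (\<bar>Y - v\<bar> + S) \<le> 8 * (K\<^sup>2 * P)"
  proof -
    have "K * \<delta>^3 * (\<bar>Y - v\<bar> + S) \<le> K * \<delta>^3 * (8 * K)"
      using YK bounds by (intro mult_left_mono) auto
    then show ?thesis by (simp add: P_def power2_eq_square mult_ac)
  qed
  have a2: "n\<^sup>2 * (S * n\<^sup>2) * (\<bar>Y - v\<bar> + S) \<le> 8 * (K\<^sup>2 * W)"
  proof -
    have "n\<^sup>2 * (S * n\<^sup>2) * (\<bar>Y - v\<bar> + S) \<le> n\<^sup>2 * (K * n\<^sup>2) * (8 * K)"
      using YK bounds S0 by (intro mult_mono mult_nonneg_nonneg) auto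
    then show ?thesis by (simp add: W_def power2_eq_square power4_eq_xxxx mult_ac)
  qed
  have a3: "n\<^sup>2 * (L * \<delta>) * (\<bar>Y - v\<bar> + S) \<le> K\<^sup>2 * P + 7 * (K\<^sup>2 * Q)"
  proof -
    have "n\<^sup>2 * (L * \<delta>) * (\<bar>Y - v\<bar> + S) \<le> n\<^sup>2 * (L * \<delta>) * (K * \<delta>\<^sup>2 + 6 * S * n\<^sup>2 + S)"
      using Y bounds by (intro mult_left_mono) auto
    also have "\<dots> = n\<^sup>2 * (L * \<delta> * (K * \<delta>\<^sup>2)) + 6 * (S * (L * \<delta>) * n\<^sup>2) * n\<^sup>2 + S * (L * \<delta>) * n\<^sup>2"
      by (simp add: algebra_simps power2_eq_square)
    also have "\<dots> \<le> L * \<delta> * (K * \<delta>\<^sup>2) + 6 * (S * (L * \<delta>) * n\<^sup>2) + S * (L * \<delta>) * n\<^sup>2"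
      using n2 bounds S0 by (intro add_mono mult_left_le_one_le mult_left_le) auto
    also have "\<dots> \<le> K\<^sup>2 * P + 7 * (K\<^sup>2 * Q)" using SL LP by linarith
    finally show ?thesis .
  qed
  have a4: "L * \<delta> * \<bar>Y - v\<bar> \<le> K\<^sup>2 * P + 6 * (K\<^sup>2 * Q)"
  proof -
    have "L * \<delta> * \<bar>Y - v\<bar> \<le> L * \<delta> * (K * \<delta>\<^sup>2 + 6 * S * n\<^sup>2)"
      using Y bounds by (intro mult_left_mono) auto
    also have "\<dots> = L * \<delta> * (K * \<delta>\<^sup>2) + 6 * (S * (L * \<delta>) * n\<^sup>2)"
      by (simp add: algebra_simps)
    finally show ?thesis using SL LP by linarith
  qed
  have a5: "\<bar>Z\<bar> \<le> 128 * (K\<^sup>2 * Q) + 128 * (K\<^sup>2 * W)"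
  proof -
    have "128 * S * n\<^sup>2 * (L * \<delta> + S * n\<^sup>2) = 128 * (S * (L * \<delta>) * n\<^sup>2) + 128 * (S * S * n^4)"
      by (simp add: algebra_simps power2_eq_square power4_eq_xxxx)
    then show ?thesis using Z SL SS by linarith
  qed
  have "X * Y + Z - w * v = (X - w) * ((Y - v) + v) + w * (Y - v) + Z"
    by (simp add: algebra_simps)
  also have "\<bar>\<dots>\<bar> \<le> \<bar>(X - w) * ((Y - v) + v)\<bar> + \<bar>w * (Y - v)\<bar> + \<bar>Z\<bar>"
    by linarith
  also have "\<dots> = \<bar>X - w\<bar> * \<bar>(Y - v) + v\<bar> + \<bar>w\<bar> * \<bar>Y - v\<bar> + \<bar>Z\<bar>"
    by (simp only: abs_mult)
  also have "\<dots> \<le> ?x * (\<bar>Y - v\<bar> + S) + L * \<delta> * \<bar>Y - v\<bar> + \<bar>Z\<bar>"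
    using X v w by (intro add_mono mult_mono order_refl) auto
  also have "?x * (\<bar>Y - v\<bar> + S) = K * \<delta>^3 * (\<bar>Y - v\<bar> + S) + 8 * (n\<^sup>2 * (L * \<delta>) * (\<bar>Y - v\<bar> + S))
      + 8 * (n\<^sup>2 * (S * n\<^sup>2) * (\<bar>Y - v\<bar> + S))"
    by (simp add: algebra_simps)
  finally have le: "\<bar>X * Y + Z - w * v\<bar> \<le> K * \<delta>^3 * (\<bar>Y - v\<bar> + S)
      + 8 * (n\<^sup>2 * (L * \<delta>) * (\<bar>Y - v\<bar> + S)) + 8 * (n\<^sup>2 * (S * n\<^sup>2) * (\<bar>Y - v\<bar> + S))
      + L * \<delta> * \<bar>Y - v\<bar> + \<bar>Z\<bar>" .
  have main: "\<bar>X * Y + Z - w * v\<bar> \<le> 300 * K\<^sup>2 * (P + Q + W)"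
  proof -
    have "0 \<le> K\<^sup>2 * P" "0 \<le> K\<^sup>2 * Q" "0 \<le> K\<^sup>2 * W" using PQW by auto
    moreover have "300 * K\<^sup>2 * (P + Q + W) = 300 * (K\<^sup>2 * P) + 300 * (K\<^sup>2 * Q) + 300 * (K\<^sup>2 * W)"
      by (simp add: distrib_left)
    ultimately show ?thesis using le a1 a2 a3 a4 a5 by linarith
  qed
  have "\<bar>\<sigma> * (X * Y + Z) - \<sigma> * (w * v)\<bar> = \<bar>\<sigma>\<bar> * \<bar>X * Y + Z - w * v\<bar>"
    by (simp add: abs_mult[symmetric] algebra_simps)
  also have "\<dots> \<le> (8 * n) * (300 * K\<^sup>2 * (P + Q + W))"
    using \<sigma> main bounds by (intro mult_mono) auto
  also have "\<dots> = 2400 * (K\<^sup>2 * error_scale z \<delta> n)"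
    by (simp add: error_scale_def P_def Q_def W_def algebra_simps eval_nat_numeral)
  also have "\<dots> \<le> 3000 * (K\<^sup>2 * error_scale z \<delta> n)"
    using z0 bounds by (intro mult_right_mono) (auto simp: error_scale_def)
  finally show ?thesis by (simp add: mult_ac)
qed

text \<open>
  The lower bound for \<open>sin (2 * \<beta>)\<close> is Jordan's inequality, from concavity of the sine: \<open>2 * \<beta>\<close>
  is the fraction \<open>1 / N\<close> of a right angle.
\<close>

lemma sin_angle_bounds:
  assumes N: "0 < N" and \<beta>: "\<bar>\<beta>\<bar> = pi / (4 * real N)"
  shows "(sin \<beta>)\<^sup>2 \<le> (1 / real N)\<^sup>2" "(sin \<beta>)\<^sup>2 \<le> 1 / 2"
    "1 / real N \<le> \<bar>sin (2 * \<beta>)\<bar>" "\<bar>sin (2 * \<beta>)\<bar> \<le> 2 / real N"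
proof -
  have pi4: "pi \<le> 4" using pi_less_4 by simp
  have N1: "1 \<le> real N" using N by simp
  have s: "\<bar>sin \<beta>\<bar> \<le> 1 / real N"
  proof -
    have "\<bar>sin \<beta>\<bar> \<le> \<bar>\<beta>\<bar>" by (rule abs_sin_x_le_abs_x)
    also have "\<dots> \<le> 1 / real N" unfolding \<beta> using N pi4 by (simp add: field_simps)
    finally show ?thesis .
  qed
  show "(sin \<beta>)\<^sup>2 \<le> (1 / real N)\<^sup>2" using power_mono[OF s, of 2] by simp
  have "cos (2 * \<beta>) \<ge> 0"
  proof (rule cos_ge_zero)
    have "\<bar>2 * \<beta>\<bar> \<le> pi / 2" unfolding abs_mult \<beta> using N1 by (simp add: field_simps)
    then show "- (pi / 2) \<le> 2 * \<beta>" "2 * \<beta> \<le> pi / 2" by linarith+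
  qed
  then show "(sin \<beta>)\<^sup>2 \<le> 1 / 2" by (simp add: cos_double_sin)
  have "\<bar>sin (2 * \<beta>)\<bar> \<le> \<bar>2 * \<beta>\<bar>" by (rule abs_sin_x_le_abs_x)
  also have "\<dots> \<le> 2 / real N" unfolding abs_mult \<beta> using N pi4 by (simp add: field_simps)
  finally show "\<bar>sin (2 * \<beta>)\<bar> \<le> 2 / real N" .
  have x: "\<bar>2 * \<beta>\<bar> = pi / 2 * (1 / real N)" unfolding abs_mult \<beta> by simp
  have "convex_on {0..pi} (\<lambda>x. - sin x)"
    by (rule f''_ge0_imp_convex[where f' = "\<lambda>x. - cos x" and f'' = sin])
      (auto intro!: derivative_eq_intros sin_ge_zero)
  from convex_onD[OF this, of "1 / real N" 0 "pi / 2"] have "sin \<bar>2 * \<beta>\<bar> \<ge> 1 / real N"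
    unfolding x using N1 by (simp add: mult.commute)
  then show "1 / real N \<le> \<bar>sin (2 * \<beta>)\<bar>"
    by (cases "0 \<le> \<beta>") auto
qed

text \<open>
  A transversal displacement of order \<open>t * n\<close> changes the norm only to second order, because
  \<open>(R - t) * (R + t) = R\<^sup>2 - t\<^sup>2\<close>.
\<close>

lemma radius_from_coordinates:
  fixes x :: "real^2"
  assumes x1: "\<bar>x$1 - t\<bar> \<le> 24 * z * n\<^sup>2" and x2: "\<bar>x$2\<bar> \<le> 12 * t * n"
    and t: "0 < t" "t \<le> z"
  shows "\<bar>norm x - t\<bar> \<le> 168 * z * n\<^sup>2"
proof -
  let ?R = "norm x"
  have R2: "?R\<^sup>2 = (x$1)\<^sup>2 + (x$2)\<^sup>2"
    by (simp add: norm_vec_def L2_set_def sum_2)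
  have x1R: "\<bar>x$1 + t\<bar> \<le> ?R + t"
    using component_le_norm_cart[of x 1] t by linarith
  have "(?R - t) * (?R + t) = (x$1 - t) * (x$1 + t) + (x$2)\<^sup>2"
    using R2 by (simp add: algebra_simps power2_eq_square)
  then have "\<bar>?R - t\<bar> * \<bar>?R + t\<bar> \<le> \<bar>x$1 - t\<bar> * \<bar>x$1 + t\<bar> + (x$2)\<^sup>2"
    unfolding abs_mult[symmetric] using zero_le_power2[of "x$2"] by linarith
  then have "\<bar>?R - t\<bar> * (?R + t) \<le> \<bar>x$1 - t\<bar> * \<bar>x$1 + t\<bar> + (x$2)\<^sup>2"
    using t by simp
  also have "\<dots> \<le> 24 * z * n\<^sup>2 * (?R + t) + 144 * z * n\<^sup>2 * (?R + t)"
  proof (rule add_mono)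
    show "\<bar>x$1 - t\<bar> * \<bar>x$1 + t\<bar> \<le> 24 * z * n\<^sup>2 * (?R + t)"
      using x1 x1R t by (intro mult_mono) auto
    have "(x$2)\<^sup>2 \<le> (12 * t * n)\<^sup>2"
      using power_mono[OF x2, of 2] by simp
    also have "\<dots> = 144 * n\<^sup>2 * (t * t)" by (simp add: power2_eq_square)
    also have "\<dots> \<le> 144 * n\<^sup>2 * (z * (?R + t))"
      using t by (intro mult_left_mono mult_mono) auto
    finally show "(x$2)\<^sup>2 \<le> 144 * z * n\<^sup>2 * (?R + t)" by (simp only: mult_ac)
  qed
  also have "\<dots> = 168 * z * n\<^sup>2 * (?R + t)" by (simp add: algebra_simps)
  finally show ?thesis
    using t by (simp add: add_nonneg_pos)
qed

section \<open>Leading order of the Jacobian of a curved element\<close>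

text \<open>
  Common size bounds for nodal values \<open>A, B, C\<close>, an intermediate value \<open>v\<close> and a slope \<open>w\<close>: \<open>S\<close>
  bounds values, \<open>L * \<delta>\<close> bounds increments. The balance \<open>S * L \<le> K * z\<close> holds in the two cases of
  interest for opposite reasons: the radii themselves are at most \<open>z\<close> with slope \<open>1\<close>, whereas
  the deformed radii are merely bounded but have slope at most a multiple of \<open>z\<close>.
\<close>

definition nodal_scales ::
  "real \<Rightarrow> real \<Rightarrow> real \<Rightarrow> real \<Rightarrow> real \<Rightarrow> real \<Rightarrow> real \<Rightarrow> real \<Rightarrow> real \<Rightarrow> real \<Rightarrow> bool" where
  "nodal_scales S L K z \<delta> A B C w v \<longleftrightarrow>
     \<bar>A\<bar> \<le> S \<and> \<bar>B\<bar> \<le> S \<and> \<bar>C\<bar> \<le> S \<and> \<bar>v\<bar> \<le> S \<and>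
     \<bar>B - A\<bar> \<le> L * \<delta> \<and> \<bar>C - B\<bar> \<le> L * \<delta> \<and> \<bar>w\<bar> \<le> L * \<delta> \<and>
     S \<le> K \<and> 0 \<le> L \<and> L \<le> K \<and> S * L \<le> K * z \<and> 1 \<le> K \<and> 0 \<le> \<delta> \<and> \<delta> \<le> 1"

lemma ref_triangle_wedge_coordinates:
  assumes "y \<in> ref_triangle"
  shows "0 \<le> y$1 + y$2" "y$1 + y$2 \<le> 1" "\<bar>y$2 - y$1\<bar> \<le> y$1 + y$2"
    "(y$2 - y$1)\<^sup>2 \<le> 1" "(y$2 - y$1)\<^sup>2 \<le> y$1 + y$2"
proof -
  show s: "0 \<le> y$1 + y$2" "y$1 + y$2 \<le> 1" and d: "\<bar>y$2 - y$1\<bar> \<le> y$1 + y$2"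
    using assms by (auto simp: ref_triangle_def)
  have "(y$2 - y$1)\<^sup>2 \<le> (y$1 + y$2)\<^sup>2"
    using power_mono[OF d, of 2] by simp
  also have "\<dots> \<le> y$1 + y$2"
    using s by (simp add: power2_eq_square mult_left_le)
  finally show "(y$2 - y$1)\<^sup>2 \<le> y$1 + y$2" .
  then show "(y$2 - y$1)\<^sup>2 \<le> 1" using s by linarith
qed

lemma quad_jac_wedge_estimate:
  fixes y :: "real^2"
  assumes a: "wedge_nodes A B C \<beta> a" and N: "0 < N" and \<beta>: "\<bar>\<beta>\<bar> = pi / (4 * real N)"
    and y: "y \<in> ref_triangle"
    and sc: "nodal_scales S L K z \<delta> A B C w v"
    and w: "\<bar>interp_slope A B C (y$1 + y$2) - w\<bar> \<le> K * \<delta>^3"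
    and v: "\<bar>B * (2 - 2 * (y$1 + y$2)) + C * (2 * (y$1 + y$2) - 1) - v\<bar> \<le> K * \<delta>\<^sup>2"
  shows "\<bar>quad_jac a y - 4 * sin (2 * \<beta>) * (w * v)\<bar> \<le> 3000 * K\<^sup>2 * error_scale z \<delta> (1 / real N)"
proof -
  define n where "n = 1 / real N"
  define s d x where "s = y$1 + y$2" and "d = y$2 - y$1" and "x = (sin \<beta>)\<^sup>2"
  have sn: "(sin \<beta>)\<^sup>2 \<le> n\<^sup>2" "(sin \<beta>)\<^sup>2 \<le> 1 / 2" "\<bar>sin (2 * \<beta>)\<bar> \<le> 2 * n"
    using sin_angle_bounds[OF N \<beta>] by (simp_all add: n_def)
  have x: "0 \<le> x" "x \<le> n\<^sup>2" "x \<le> 1 / 2" using sn by (simp_all add: x_def)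
  have s: "0 \<le> s" "s \<le> 1" and d: "d\<^sup>2 \<le> 1"
    using ref_triangle_wedge_coordinates[OF y] by (simp_all add: s_def d_def)
  have sc': "\<bar>C\<bar> \<le> S" "\<bar>C - B\<bar> \<le> L * \<delta>" "0 \<le> L * \<delta>" "0 \<le> L" "0 \<le> \<delta>"
    using sc unfolding nodal_scales_def by simp_all
  have S0: "0 \<le> S" using sc'(1) by linarith
  note sc' = sc' S0
  have Cx: "\<bar>C * x\<bar> \<le> S * n\<^sup>2"
    unfolding abs_mult using sc'(1) x S0 by (intro mult_mono; (assumption | simp))
  have s1: "\<bar>1 - 2 * s\<bar> \<le> 1" "\<bar>2 * s - 1\<bar> \<le> 1" using s by auto
  have CB: "\<bar>C - B - C * x\<bar> \<le> L * \<delta> + S * n\<^sup>2" "\<bar>C - B - 2 * C * x\<bar> \<le> 2 * (L * \<delta> + S * n\<^sup>2)"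
  proof -
    have "\<bar>C - B - u\<bar> \<le> L * \<delta> + \<bar>u\<bar>" for u using sc'(2) by linarith
    from this[of "C * x"] this[of "2 * (C * x)"]
    have "\<bar>C - B - C * x\<bar> \<le> L * \<delta> + \<bar>C * x\<bar>" "\<bar>C - B - 2 * C * x\<bar> \<le> L * \<delta> + 2 * \<bar>C * x\<bar>"
      by (simp_all add: abs_mult)
    then have "\<bar>C - B - C * x\<bar> \<le> L * \<delta> + S * n\<^sup>2" "\<bar>C - B - 2 * C * x\<bar> \<le> 2 * (L * \<delta>) + 2 * (S * n\<^sup>2)"
      using Cx sc'(3) by linarith+
    then show "\<bar>C - B - C * x\<bar> \<le> L * \<delta> + S * n\<^sup>2" "\<bar>C - B - 2 * C * x\<bar> \<le> 2 * (L * \<delta> + S * n\<^sup>2)"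
      by (simp_all only: distrib_left)
  qed
  have nS: "0 \<le> S * n\<^sup>2" "0 \<le> L * \<delta> + S * n\<^sup>2" using sc' by simp_all
  have X: "\<bar>8 * x * (1 - 2 * s) * (C - B - C * x)\<bar> \<le> 8 * n\<^sup>2 * (L * \<delta> + S * n\<^sup>2)"
  proof -
    have "\<bar>8 * x * (1 - 2 * s) * (C - B - C * x)\<bar> = 8 * (x * \<bar>1 - 2 * s\<bar>) * \<bar>C - B - C * x\<bar>"
      using x by (simp add: abs_mult)
    also have "\<dots> \<le> 8 * (n\<^sup>2 * 1) * (L * \<delta> + S * n\<^sup>2)"
      using x s1 CB nS by (intro mult_mono; (assumption | simp))
    finally show ?thesis by simp
  qed
  have Y: "\<bar>2 * C * x * (2 * s - 1)\<bar> \<le> 6 * S * n\<^sup>2"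
  proof -
    have "\<bar>2 * C * x * (2 * s - 1)\<bar> = 2 * \<bar>C * x\<bar> * \<bar>2 * s - 1\<bar>" by (simp add: abs_mult)
    also have "\<dots> \<le> 2 * (S * n\<^sup>2) * 1" using Cx s1 nS by (intro mult_mono; (assumption | simp))
    also have "\<dots> \<le> 6 * S * n\<^sup>2" using sc' by simp
    finally show ?thesis .
  qed
  have Z: "\<bar>32 * x * (1 - x) * C * d\<^sup>2 * (C - B - 2 * C * x)\<bar> \<le> 128 * S * n\<^sup>2 * (L * \<delta> + S * n\<^sup>2)"
  proof -
    have "\<bar>32 * x * (1 - x) * C * d\<^sup>2 * (C - B - 2 * C * x)\<bar>
        = 32 * ((1 - x) * \<bar>C * x\<bar> * d\<^sup>2) * \<bar>C - B - 2 * C * x\<bar>"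
      using x by (simp add: abs_mult)
    also have "\<dots> \<le> 32 * (1 * (S * n\<^sup>2) * 1) * (2 * (L * \<delta> + S * n\<^sup>2))"
      using x d CB Cx nS S0 by (intro mult_mono mult_nonneg_nonneg; (assumption | simp))
    also have "\<dots> = 64 * (S * n\<^sup>2 * (L * \<delta> + S * n\<^sup>2))" by simp
    also have "\<dots> \<le> 128 * (S * n\<^sup>2 * (L * \<delta> + S * n\<^sup>2))"
      using sc' by (intro mult_right_mono mult_nonneg_nonneg add_nonneg_nonneg) simp_all
    also have "\<dots> = 128 * S * n\<^sup>2 * (L * \<delta> + S * n\<^sup>2)" by simp
    finally show ?thesis .
  qed
  define E1 E2 E3 where "E1 = 8 * x * (1 - 2 * s) * (C - B - C * x)" and "E2 = 2 * C * x * (2 * s - 1)" and "E3 = 32 * x * (1 - x) * C * d\<^sup>2 * (C - B - 2 * C * x)"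
  define G H where "G = interp_slope A B C s" and "H = B * (2 - 2 * s) + C * (2 * s - 1)"
  have n1: "0 \<le> n" "n \<le> 1" using N by (simp_all add: n_def)
  have "\<bar>4 * sin (2 * \<beta>) * ((G + E1) * (H - E2) + E3) - 4 * sin (2 * \<beta>) * (w * v)\<bar>
      \<le> 3000 * K\<^sup>2 * error_scale z \<delta> n"
  proof (rule slope_radius_product_estimate[where S = S and L = L])
    show "\<bar>G + E1 - w\<bar> \<le> K * \<delta>^3 + 8 * n\<^sup>2 * (L * \<delta> + S * n\<^sup>2)"
      using X[folded E1_def] w[folded s_def] unfolding G_def by linarith
    show "\<bar>H - E2 - v\<bar> \<le> K * \<delta>\<^sup>2 + 6 * S * n\<^sup>2"
      using Y[folded E2_def] v[folded s_def] unfolding H_def by linarith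
    show "\<bar>E3\<bar> \<le> 128 * S * n\<^sup>2 * (L * \<delta> + S * n\<^sup>2)"
      using Z unfolding E3_def .
    show "\<bar>4 * sin (2 * \<beta>)\<bar> \<le> 8 * n"
      using sn(3) by (simp add: abs_mult)
  qed (use sc n1 in \<open>simp_all add: nodal_scales_def\<close>)
  then show ?thesis
    unfolding quad_jac_wedge[OF a] G_def H_def E1_def E2_def E3_def s_def d_def x_def n_def .
qed

lemma quad_jac_strip_estimate:
  fixes y :: "real^2"
  assumes a: "strip_nodes A B C \<beta> a" and N: "0 < N" and \<beta>: "\<bar>\<beta>\<bar> = pi / (4 * real N)"
    and y: "y \<in> ref_triangle"
    and sc: "nodal_scales S L K z \<delta> A B C w v"
    and w: "\<bar>interp_slope A B C (y$1) - w\<bar> \<le> K * \<delta>^3"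
    and v: "\<bar>A * (1 - 2 * y$1) + B * (2 * y$1) - v\<bar> \<le> K * \<delta>\<^sup>2"
  shows "\<bar>quad_jac a y - 2 * sin (2 * \<beta>) * (w * v)\<bar> \<le> 3000 * K\<^sup>2 * error_scale z \<delta> (1 / real N)"
proof -
  define n where "n = 1 / real N"
  define s b x where "s = y$1" and "b = y$2" and "x = (sin \<beta>)\<^sup>2"
  have sn: "(sin \<beta>)\<^sup>2 \<le> n\<^sup>2" "(sin \<beta>)\<^sup>2 \<le> 1 / 2" "\<bar>sin (2 * \<beta>)\<bar> \<le> 2 * n"
    using sin_angle_bounds[OF N \<beta>] by (simp_all add: n_def)
  have x: "0 \<le> x" "x \<le> n\<^sup>2" "x \<le> 1 / 2" using sn by (simp_all add: x_def)
  have s: "0 \<le> s" "s \<le> 1" and b: "0 \<le> b" "b \<le> 1"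
    using y by (auto simp: ref_triangle_def s_def b_def)
  have sc': "\<bar>A\<bar> \<le> S" "\<bar>B\<bar> \<le> S" "\<bar>B - A\<bar> \<le> L * \<delta>" "0 \<le> L * \<delta>" "0 \<le> L" "0 \<le> \<delta>"
    using sc unfolding nodal_scales_def by simp_all
  have S0: "0 \<le> S" using sc'(1) by linarith
  note sc' = sc' S0
  have Ax: "\<bar>A * x\<bar> \<le> S * n\<^sup>2" "\<bar>A * x\<bar> \<le> S * 1"
    unfolding abs_mult using sc'(1) x S0 by (intro mult_mono; (assumption | simp))+
  have b4: "\<bar>4 * b - 1\<bar> \<le> 3" using b by auto
  have nS: "0 \<le> S * n\<^sup>2" "0 \<le> L * \<delta> + S * n\<^sup>2" using sc' by simp_all
  have LS: "\<bar>B - A\<bar> \<le> L * \<delta> + S * n\<^sup>2" using sc'(3) nS by linarith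
  have xb: "0 \<le> x * b" "x * b \<le> n\<^sup>2"
    using x b mult_mono[of x "n\<^sup>2" b 1] by auto
  have X: "\<bar>8 * x * b * (B - A)\<bar> \<le> 8 * n\<^sup>2 * (L * \<delta> + S * n\<^sup>2)"
  proof -
    have "\<bar>8 * x * b * (B - A)\<bar> = 8 * (x * b) * \<bar>B - A\<bar>"
      using x b by (simp add: abs_mult)
    also have "\<dots> \<le> 8 * n\<^sup>2 * (L * \<delta> + S * n\<^sup>2)"
      using LS xb nS by (intro mult_mono; (assumption | simp))
    finally show ?thesis .
  qed
  have Y: "\<bar>2 * A * x * (4 * b - 1)\<bar> \<le> 6 * S * n\<^sup>2"
  proof -
    have "\<bar>2 * A * x * (4 * b - 1)\<bar> = 2 * \<bar>A * x\<bar> * \<bar>4 * b - 1\<bar>" by (simp add: abs_mult)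
    also have "\<dots> \<le> 2 * (S * n\<^sup>2) * 3" using Ax(1) b4 nS by (intro mult_mono; (assumption | simp))
    finally show ?thesis by simp
  qed
  have Z: "\<bar>16 * x * b * (B - A) * (2 * A * b + (B - A) * s - A * x * (4 * b - 1))\<bar>
      \<le> 128 * S * n\<^sup>2 * (L * \<delta> + S * n\<^sup>2)"
  proof -
    have BA: "\<bar>B - A\<bar> \<le> 2 * S" using sc'(1,2) by linarith
    have "\<bar>A * b\<bar> \<le> S * 1" "\<bar>(B - A) * s\<bar> \<le> (2 * S) * 1" "\<bar>A * x * (4 * b - 1)\<bar> \<le> (S * 1) * 3"
      unfolding abs_mult[of _ b] abs_mult[of _ s] abs_mult[of _ "4 * b - 1"] abs_of_nonneg[OF b(1)]
        abs_of_nonneg[OF s(1)]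
      using sc'(1) BA b s Ax(2) b4 S0 by (intro mult_mono; (assumption | simp))+
    then have "\<bar>2 * A * b + (B - A) * s - A * x * (4 * b - 1)\<bar> \<le> 8 * S"
      unfolding mult.assoc[of 2 A b] by linarith
    then have "16 * (x * b) * \<bar>B - A\<bar> * \<bar>2 * A * b + (B - A) * s - A * x * (4 * b - 1)\<bar>
        \<le> 16 * n\<^sup>2 * (L * \<delta>) * (8 * S)"
      using xb sc'(3-) x b by (intro mult_mono mult_nonneg_nonneg; (assumption | simp))
    moreover have "\<bar>16 * x * b * (B - A) * (2 * A * b + (B - A) * s - A * x * (4 * b - 1))\<bar>
        = 16 * (x * b) * \<bar>B - A\<bar> * \<bar>2 * A * b + (B - A) * s - A * x * (4 * b - 1)\<bar>"
      using x b by (simp add: abs_mult)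
    ultimately have "\<bar>16 * x * b * (B - A) * (2 * A * b + (B - A) * s - A * x * (4 * b - 1))\<bar>
        \<le> 16 * n\<^sup>2 * (L * \<delta>) * (8 * S)" by linarith
    also have "\<dots> \<le> 128 * S * n\<^sup>2 * (L * \<delta> + S * n\<^sup>2)"
      using sc' by (simp add: algebra_simps)
    finally show ?thesis .
  qed
  define E1 E2 E3 where "E1 = 8 * x * b * (B - A)" and "E2 = 2 * A * x * (4 * b - 1)" and "E3 = 16 * x * b * (B - A) * (2 * A * b + (B - A) * s - A * x * (4 * b - 1))"
  define G H where "G = interp_slope A B C s" and "H = A * (1 - 2 * s) + B * (2 * s)"
  have n1: "0 \<le> n" "n \<le> 1" using N by (simp_all add: n_def)
  have "\<bar>2 * sin (2 * \<beta>) * ((G - E1) * (H - E2) + E3) - 2 * sin (2 * \<beta>) * (w * v)\<bar>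
      \<le> 3000 * K\<^sup>2 * error_scale z \<delta> n"
  proof (rule slope_radius_product_estimate[where S = S and L = L])
    show "\<bar>G - E1 - w\<bar> \<le> K * \<delta>^3 + 8 * n\<^sup>2 * (L * \<delta> + S * n\<^sup>2)"
      using X[folded E1_def] w[folded s_def] unfolding G_def by linarith
    show "\<bar>H - E2 - v\<bar> \<le> K * \<delta>\<^sup>2 + 6 * S * n\<^sup>2"
      using Y[folded E2_def] v[folded s_def] unfolding H_def by linarith
    show "\<bar>E3\<bar> \<le> 128 * S * n\<^sup>2 * (L * \<delta> + S * n\<^sup>2)"
      using Z unfolding E3_def .
    show "\<bar>2 * sin (2 * \<beta>)\<bar> \<le> 8 * n"
      using sn(3) by (simp add: abs_mult)
  qed (use sc n1 in \<open>simp_all add: nodal_scales_def\<close>)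
  then show ?thesis
    unfolding quad_jac_strip[OF a] G_def H_def E1_def E2_def E3_def s_def b_def x_def n_def .
qed

section \<open>The reference map: radius and nondegeneracy\<close>

text \<open>
  Here \<open>h\<close> may be negative, which makes outward and inward wedges one case.
\<close>

lemma intermediate_radius:
  fixes e h s z :: real
  assumes "0 < e" "0 < e + h" "e \<le> z" "e + h \<le> z" "0 \<le> s" "s \<le> 1"
  shows "0 < e + s * h" "e + s * h \<le> z"
proof -
  have "e + s * h = (1 - s) * e + s * (e + h)" by (simp add: algebra_simps)
  moreover have "(1 - s) * e + s * (e + h) \<le> z" using assms by (intro convex_bound_le) auto
  moreover have "0 < (1 - s) * e + s * (e + h)"
    using assms by (cases "s = 0") (auto intro!: add_nonneg_pos)
  ultimately show "0 < e + s * h" "e + s * h \<le> z" by auto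
qed

text \<open>
  Quadratic interpolation of an arc of radius at most \<open>z\<close> and angle of order \<open>1 / N\<close> displaces points
  radially by \<open>O (z / N\<^sup>2)\<close>. The transversal component must be compared with \<open>t\<close> rather than \<open>z\<close>: it
  carries the factor \<open>d\<close>, and \<open>\<bar>d\<bar> \<le> s\<close> turns the outer radius \<open>C\<close> into \<open>s * C \<le> t\<close>.
\<close>

lemma norm_quad_map_wedge:
  fixes y :: "real^2"
  assumes a: "wedge_nodes e (e + h / 2) (e + h) \<beta> a" and N: "0 < N" and \<beta>: "\<bar>\<beta>\<bar> = pi / (4 * real N)"
    and y: "y \<in> ref_triangle"
    and e: "0 < e" "0 < e + h" "e \<le> z" "e + h \<le> z"
  shows "\<bar>norm (quad_map a y) - (e + (y$1 + y$2) * h)\<bar> \<le> 168 * z * (1 / real N)\<^sup>2"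
proof -
  define n where "n = 1 / real N"
  define s d x where "s = y$1 + y$2" and "d = y$2 - y$1" and "x = (sin \<beta>)\<^sup>2"
  define t B C where "t = e + s * h" and "B = e + h / 2" and "C = e + h"
  have sn: "(sin \<beta>)\<^sup>2 \<le> n\<^sup>2" "(sin \<beta>)\<^sup>2 \<le> 1 / 2" "\<bar>sin (2 * \<beta>)\<bar> \<le> 2 * n"
    using sin_angle_bounds[OF N \<beta>] by (simp_all add: n_def)
  have x: "0 \<le> x" "x \<le> n\<^sup>2" "x \<le> 1 / 2" using sn by (simp_all add: x_def)
  have s: "0 \<le> s" "s \<le> 1" and d: "d\<^sup>2 \<le> 1" "\<bar>d\<bar> \<le> s"
    using ref_triangle_wedge_coordinates[OF y] by (simp_all add: s_def d_def)
  have n0: "0 \<le> n" by (simp add: n_def)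
  have BC: "0 < B" "B \<le> z" "0 < C" "C \<le> z" using e by (simp_all add: B_def C_def)
  have t_conv: "t = (1 - s) * e + s * C" by (simp add: t_def C_def algebra_simps)
  have se: "0 \<le> (1 - s) * e" "0 \<le> s * C" using s e BC by simp_all
  have t0: "0 < t" and tz: "t \<le> z"
    unfolding t_def using intermediate_radius[of e h z s] e s by simp_all
  have bub: "s * (1 - s) \<le> 1" "0 \<le> s * (1 - s)" using s mult_le_one[of s "1 - s"] by auto
  have x1: "\<bar>quad_map a y $ 1 - t\<bar> \<le> 24 * z * n\<^sup>2"
  proof -
    have "quad_map a y $ 1 - t = - 8 * (B * x * (s * (1 - s))) + 8 * (C * x * ((1 - x) * (s * (1 - s) - d\<^sup>2)))"
      unfolding quad_map_wedge(1)[OF a] t_def B_def C_def s_def[symmetric] d_def[symmetric] x_def[symmetric]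
      by (simp add: field_simps power2_eq_square)
    moreover have "0 \<le> B * x * (s * (1 - s))" "B * x * (s * (1 - s)) \<le> (z * n\<^sup>2) * 1"
      using BC x bub by (simp, intro mult_mono) auto
    moreover have "\<bar>C * x * ((1 - x) * (s * (1 - s) - d\<^sup>2))\<bar> \<le> (z * n\<^sup>2) * (1 * 1)"
    proof -
      have "\<bar>s * (1 - s) - d\<^sup>2\<bar> \<le> 1" using bub d zero_le_power2[of d] by linarith
      then show ?thesis
        unfolding abs_mult using BC x by (intro mult_mono) auto
    qed
    ultimately show ?thesis by linarith
  qed
  have x2: "\<bar>quad_map a y $ 2\<bar> \<le> 12 * t * n"
  proof -
    have "\<bar>d\<bar> * t \<le> t" using t0 d s by (simp add: mult_left_le_one_le)
    moreover have "\<bar>d\<bar> * C \<le> t"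
      using mult_right_mono[OF d(2), of C] BC se t_conv by linarith
    moreover have "\<bar>2 * x * (2 * s - 1)\<bar> \<le> 1"
    proof -
      have "\<bar>2 * s - 1\<bar> \<le> 1" using s by auto
      then have "\<bar>2 * x\<bar> * \<bar>2 * s - 1\<bar> \<le> 1 * 1" using x by (intro mult_mono) auto
      then show ?thesis by (simp add: abs_mult)
    qed
    ultimately have *: "\<bar>d\<bar> * t + \<bar>d\<bar> * C * \<bar>2 * x * (2 * s - 1)\<bar> \<le> 2 * t"
      using mult_left_le[of "\<bar>2 * x * (2 * s - 1)\<bar>" "\<bar>d\<bar> * C"] BC by simp
    have "quad_map a y $ 2 = 2 * sin (2 * \<beta>) * (d * t - d * C * (2 * x * (2 * s - 1)))"
      unfolding quad_map_wedge(2)[OF a] t_def C_def s_def[symmetric] d_def[symmetric] x_def[symmetric]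
      by (simp add: algebra_simps)
    also have "\<bar>\<dots>\<bar> = 2 * \<bar>sin (2 * \<beta>)\<bar> * \<bar>d * t - d * C * (2 * x * (2 * s - 1))\<bar>"
      by (simp add: abs_mult)
    also have "\<dots> \<le> 2 * (2 * n) * (2 * t)"
    proof -
      have "\<bar>d * t - d * C * (2 * x * (2 * s - 1))\<bar> \<le> \<bar>d * t\<bar> + \<bar>d * C * (2 * x * (2 * s - 1))\<bar>"
        by linarith
      also have "\<dots> = \<bar>d\<bar> * t + \<bar>d\<bar> * C * \<bar>2 * x * (2 * s - 1)\<bar>"
        using t0 BC by (simp add: abs_mult)
      finally have "\<bar>d * t - d * C * (2 * x * (2 * s - 1))\<bar> \<le> 2 * t" using * by linarith
      then show ?thesis using sn n0 by (intro mult_mono) auto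
    qed
    also have "\<dots> \<le> 12 * t * n" using t0 n0 by simp
    finally show ?thesis .
  qed
  show ?thesis
    using radius_from_coordinates[OF x1 x2 t0 tz] by (simp add: t_def s_def n_def)
qed

text \<open>
  As for wedges; the inner radius \<open>e\<close> is at most \<open>t\<close> throughout the strip.
\<close>

lemma norm_quad_map_strip:
  fixes y :: "real^2"
  assumes a: "strip_nodes e (e + h / 2) (e + h) \<beta> a" and N: "0 < N" and \<beta>: "\<bar>\<beta>\<bar> = pi / (4 * real N)"
    and y: "y \<in> ref_triangle"
    and e: "0 < e" "0 < h" "e + h \<le> z"
  shows "\<bar>norm (quad_map a y) - (e + y$1 * h)\<bar> \<le> 168 * z * (1 / real N)\<^sup>2"
proof -
  define n where "n = 1 / real N"
  define s b x where "s = y$1" and "b = y$2" and "x = (sin \<beta>)\<^sup>2"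
  define t where "t = e + s * h"
  have sn: "(sin \<beta>)\<^sup>2 \<le> n\<^sup>2" "(sin \<beta>)\<^sup>2 \<le> 1 / 2" "\<bar>sin (2 * \<beta>)\<bar> \<le> 2 * n"
    using sin_angle_bounds[OF N \<beta>] by (simp_all add: n_def)
  have x: "0 \<le> x" "x \<le> n\<^sup>2" "x \<le> 1 / 2" using sn by (simp_all add: x_def)
  have s: "0 \<le> s" "s \<le> 1" and b: "0 \<le> b" "b \<le> 1"
    using y by (auto simp: ref_triangle_def s_def b_def)
  have n0: "0 \<le> n" by (simp add: n_def)
  have sh: "0 \<le> s * h" "s * h \<le> h" using s e by (simp_all add: mult_left_le_one_le)
  have t0: "0 < t" and te: "e \<le> t" and tz: "t \<le> z"
    unfolding t_def using sh e by linarith+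
  have b1: "\<bar>2 * b - 1\<bar> \<le> 1" using b by auto
  have b2: "\<bar>2 * x * (2 * b - 1)\<bar> \<le> 1"
  proof -
    have "\<bar>2 * x\<bar> * \<bar>2 * b - 1\<bar> \<le> 1 * 1" using x b1 by (intro mult_mono) auto
    then show ?thesis by (simp add: abs_mult)
  qed
  have eb: "\<bar>e * (2 * x * (2 * b - 1))\<bar> \<le> e"
    using mult_left_mono[OF b2, of e] e by (simp add: abs_mult)
  have x1: "\<bar>quad_map a y $ 1 - t\<bar> \<le> 24 * z * n\<^sup>2"
  proof -
    have "quad_map a y $ 1 - t = - 8 * (x * b * (e * b + s * h / 2 - e * (2 * x * (2 * b - 1)) / 2))"
      unfolding quad_map_strip(1)[OF a] t_def s_def[symmetric] b_def[symmetric] x_def[symmetric]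
      by (simp add: field_simps power2_eq_square)
    moreover have "\<bar>x * b * (e * b + s * h / 2 - e * (2 * x * (2 * b - 1)) / 2)\<bar> \<le> n\<^sup>2 * 1 * (3 * z)"
    proof -
      have "0 \<le> e * b" "e * b \<le> e" using e b by (simp_all add: mult_left_le)
      then have "\<bar>e * b + s * h / 2 - e * (2 * x * (2 * b - 1)) / 2\<bar> \<le> 3 * z"
        using eb sh e by linarith
      then show ?thesis
        unfolding abs_mult using x b by (intro mult_mono) auto
    qed
    ultimately have "\<bar>quad_map a y $ 1 - t\<bar> \<le> 8 * (n\<^sup>2 * 1 * (3 * z))" by linarith
    then show ?thesis by (simp add: mult_ac)
  qed
  have x2: "\<bar>quad_map a y $ 2\<bar> \<le> 12 * t * n"
  proof -
    have "quad_map a y $ 2 = 2 * sin (2 * \<beta>) * b * (t - e * (2 * x * (2 * b - 1)))"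
      unfolding quad_map_strip(2)[OF a] t_def s_def[symmetric] b_def[symmetric] x_def[symmetric]
      by (simp add: algebra_simps)
    also have "\<bar>\<dots>\<bar> = 2 * \<bar>sin (2 * \<beta>)\<bar> * b * \<bar>t - e * (2 * x * (2 * b - 1))\<bar>"
      using b by (simp add: abs_mult)
    also have "\<dots> \<le> 2 * (2 * n) * 1 * (2 * t)"
    proof -
      have "\<bar>t - e * (2 * x * (2 * b - 1))\<bar> \<le> 2 * t" using eb te t0 by linarith
      then show ?thesis using sn n0 b by (intro mult_mono) auto
    qed
    also have "\<dots> \<le> 12 * t * n" using t0 n0 by simp
    finally show ?thesis .
  qed
  show ?thesis
    using radius_from_coordinates[OF x1 x2 t0 tz] by (simp add: t_def s_def n_def)
qed

text \<open>
  For a strip of radii the Jacobian collapses to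
  \<open>2 * \<sigma> * h * (s * h + e * (1 + 2 * \<eta>\<^sup>2 * (1 - 2 * b) * (1 - 4 * b)))\<close>. The quadratic in \<open>b\<close> is at least
  \<open>- 1 / 8\<close>, so the bracket stays above \<open>e / 2\<close> for every angle.
\<close>

lemma quad_jac_strip_lower_bound:
  fixes y :: "real^2"
  assumes a: "strip_nodes e (e + h / 2) (e + h) \<beta> a" and N: "0 < N" and \<beta>: "\<bar>\<beta>\<bar> = pi / (4 * real N)"
    and y: "y \<in> ref_triangle" and e: "0 < e" "0 < h"
  shows "e * h / real N \<le> \<bar>quad_jac a y\<bar>"
proof -
  define s b x where "s = y$1" and "b = y$2" and "x = (sin \<beta>)\<^sup>2"
  have x: "0 \<le> x" "x \<le> 1 / 2" and \<sigma>: "1 / real N \<le> \<bar>sin (2 * \<beta>)\<bar>"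
    using sin_angle_bounds[OF N \<beta>] by (simp_all add: x_def)
  have s: "0 \<le> s" using y by (simp add: ref_triangle_def s_def)
  have J: "quad_jac a y = 2 * sin (2 * \<beta>) * (h * (s * h + e * (1 + 2 * x * ((1 - 2 * b) * (1 - 4 * b)))))"
    unfolding quad_jac_strip[OF a] s_def[symmetric] b_def[symmetric] x_def[symmetric] interp_slope_def
    by (simp add: field_simps power2_eq_square)
  \<comment> \<open>completing the square\<close>
  have "(1 - 2 * b) * (1 - 4 * b) + 1 / 8 = 8 * (b - 3 / 8)\<^sup>2"
    by (simp add: power2_eq_square algebra_simps)
  then have "- (1 / 8) \<le> (1 - 2 * b) * (1 - 4 * b)"
    using zero_le_power2[of "b - 3 / 8"] by linarith
  then have "2 * x * - (1 / 8) \<le> 2 * x * ((1 - 2 * b) * (1 - 4 * b))"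
    using x by (intro mult_left_mono) auto
  then have "1 / 2 \<le> 1 + 2 * x * ((1 - 2 * b) * (1 - 4 * b))" using x by linarith
  then have "e * (1 / 2) \<le> e * (1 + 2 * x * ((1 - 2 * b) * (1 - 4 * b)))"
    using e by (intro mult_left_mono) auto
  then have br: "e / 2 \<le> s * h + e * (1 + 2 * x * ((1 - 2 * b) * (1 - 4 * b)))"
    using s e mult_nonneg_nonneg[of s h] by linarith
  have "e * h / real N = 2 * (1 / real N) * (h * (e / 2))" by simp
  also have "\<dots> \<le> 2 * \<bar>sin (2 * \<beta>)\<bar> * (h * (s * h + e * (1 + 2 * x * ((1 - 2 * b) * (1 - 4 * b)))))"
    using br \<sigma> e by (intro mult_mono) auto
  also have "\<dots> = \<bar>quad_jac a y\<bar>"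
  proof -
    have nn: "0 \<le> h * (s * h + e * (1 + 2 * x * ((1 - 2 * b) * (1 - 4 * b))))"
      using br e by (intro mult_nonneg_nonneg) linarith+
    show ?thesis
      unfolding J abs_mult[of "2 * sin (2 * \<beta>)"] abs_of_nonneg[OF nn] by (simp add: abs_mult)
  qed
  finally show ?thesis .
qed

text \<open>
  With at least two sectors the angle \<open>2 * \<beta>\<close> is at most \<open>\<pi> / 4\<close>, and \<open>1 - 2 * (sin \<beta>)\<^sup>2 \<ge> \<surd>2 / 2 \<ge> 7 / 10\<close>.
\<close>

lemma sin_eighth_turn_bound:
  assumes "2 \<le> N" and \<beta>: "\<bar>\<beta>\<bar> = pi / (4 * real N)"
  shows "(sin \<beta>)\<^sup>2 \<le> 3 / 20"
proof -
  have "\<bar>2 * \<beta>\<bar> \<le> pi / 4"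
    unfolding abs_mult \<beta> using assms(1) by (simp add: field_simps)
  then have "cos (pi / 4) \<le> cos \<bar>2 * \<beta>\<bar>"
    by (intro cos_monotone_0_pi_le) auto
  then have "sqrt 2 / 2 \<le> cos (2 * \<beta>)" by (simp add: cos_45)
  moreover have "14 / 10 \<le> sqrt 2" by (rule real_le_rsqrt) (simp add: power2_eq_square)
  ultimately show ?thesis by (simp add: cos_double_sin)
qed

text \<open>
  The only terms of the Jacobian of a wedge that can compete with \<open>h\<close> are of the form \<open>e * \<eta>\<^sup>4\<close>. The
  factor \<open>1000\<close> makes them negligible compared with the margins that the other terms leave.
\<close>

lemma resolved_imp_quartic_term_small:
  assumes N: "0 < N" and e: "0 < e" and x: "0 \<le> x" "x \<le> (1 / real N)\<^sup>2"
    and resolved: "1000 * e \<le> h * real N ^ 4"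
  shows "1000 * (e * x\<^sup>2) \<le> h"
proof -
  have "x\<^sup>2 \<le> ((1 / real N)\<^sup>2)\<^sup>2" using x by (intro power_mono)
  then have "1000 * e * x\<^sup>2 \<le> 1000 * e * (1 / real N ^ 4)"
    using e by (intro mult_left_mono) (simp_all add: power_divide flip: power_mult)
  also have "\<dots> \<le> h" using resolved N by (simp add: field_simps)
  finally show ?thesis by simp
qed

text \<open>
  For \<open>\<eta>\<^sup>2 \<le> 3 / 20\<close> the slope factor is at least \<open>h / 2\<close> and the radius factor at least \<open>7 / 10 * t\<close>.
  The mixed term is negative only through \<open>e * \<eta>\<^sup>4\<close>, since the part of it that is proportional to \<open>h\<close> has a
  favourable sign; it costs at most \<open>8 / 100 * h * t\<close>.
\<close>

lemma quad_jac_wedge_outward_lower_bound: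
  fixes y :: "real^2"
  assumes a: "wedge_nodes e (e + h / 2) (e + h) \<beta> a" and N: "2 \<le> N" and \<beta>: "\<bar>\<beta>\<bar> = pi / (4 * real N)"
    and y: "y \<in> ref_triangle" and e: "0 < e" "0 < h"
    and resolved: "1000 * e \<le> h * real N ^ 4"
  shows "e * h / real N \<le> \<bar>quad_jac a y\<bar>"
proof -
  define s d x where "s = y$1 + y$2" and "d = y$2 - y$1" and "x = (sin \<beta>)\<^sup>2"
  have N0: "0 < N" using N by simp
  have x: "0 \<le> x" "x \<le> 3 / 20" and xN: "x \<le> (1 / real N)\<^sup>2" and \<sigma>: "1 / real N \<le> \<bar>sin (2 * \<beta>)\<bar>"
    using sin_angle_bounds[OF N0 \<beta>] sin_eighth_turn_bound[OF N \<beta>] by (simp_all add: x_def)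
  have s: "0 \<le> s" "s \<le> 1" and d: "d\<^sup>2 \<le> s"
    using ref_triangle_wedge_coordinates[OF y] by (simp_all add: s_def d_def)
  define t C where "t = e + s * h" and "C = e + h"
  have C0: "0 < C" using e by (simp add: C_def)
  have et: "e \<le> t" using s e by (simp add: t_def)
  have sC: "s * C \<le> t" using s e mult_right_mono[of s 1 e] by (simp add: t_def C_def algebra_simps)
  have dC: "C * d\<^sup>2 \<le> t" using mult_right_mono[OF d, of C] C0 sC by (metis less_imp_le mult.commute order_trans)
  have ex: "1000 * (e * x\<^sup>2) \<le> h"
    using resolved_imp_quartic_term_small[OF N0 _ x(1) xN resolved] e by simp
  have s1: "\<bar>1 - 2 * s\<bar> \<le> 1" using s by auto
  have X: "h / 2 \<le> h + 8 * x * (1 - 2 * s) * (h / 2 - C * x)"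
  proof -
    have "h + 8 * x * (1 - 2 * s) * (h / 2 - C * x)
        = h - (2 * s - 1) * (h * (4 * x - 8 * x\<^sup>2)) + 8 * (2 * s - 1) * (e * x\<^sup>2)"
      by (simp add: C_def algebra_simps power2_eq_square)
    moreover have "\<bar>(2 * s - 1) * (h * (4 * x - 8 * x\<^sup>2))\<bar> \<le> 1 * (h * (42 / 100))"
    proof -
      have "4 * x - 8 * x\<^sup>2 - 42 / 100 = - 8 * (3 / 20 - x) * (7 / 20 - x)"
        by (simp add: algebra_simps power2_eq_square)
      also have "\<dots> \<le> 0" using x by (simp add: mult_nonpos_nonneg)
      finally have "4 * x - 8 * x\<^sup>2 \<le> 42 / 100" by linarith
      moreover have "0 \<le> 4 * x - 8 * x\<^sup>2"
        using x mult_nonneg_nonneg[of "4 * x" "1 - 2 * x"] by (simp add: algebra_simps power2_eq_square)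
      ultimately show ?thesis
        unfolding abs_mult using s1 e by (intro mult_mono) auto
    qed
    moreover have "\<bar>(2 * s - 1) * (e * x\<^sup>2)\<bar> \<le> 1 * (h / 1000)"
      unfolding abs_mult using s1 e ex by (intro mult_mono) auto
    ultimately show ?thesis by (simp only: mult.assoc)
  qed
  have Y: "7 / 10 * t \<le> t - 2 * C * x * (2 * s - 1)"
  proof -
    have "(2 * s - 1) * C \<le> s * C" using s C0 by (intro mult_right_mono) auto
    then have "C * (2 * s - 1) \<le> t" using sC by (metis mult.commute order_trans)
    then have "2 * x * (C * (2 * s - 1)) \<le> 2 * x * t" using x by (intro mult_left_mono) auto
    also have "\<dots> \<le> (3 / 10) * t" using x et e by (intro mult_right_mono) auto
    finally show ?thesis by (simp add: mult_ac)
  qed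
  have Z: "- (8 / 100) * (h * t) \<le> 32 * x * (1 - x) * C * d\<^sup>2 * (h / 2 - 2 * C * x)"
  proof -
    let ?D = "x * (1 - x) * (C * d\<^sup>2)"
    have D0: "0 \<le> ?D" using x C0 by simp
    have Dx: "?D \<le> x * 1 * t" using x dC C0 by (intro mult_mono) auto
    \<comment> \<open>separating the favourable part, proportional to \<open>h\<close>, from the part that \<open>resolved\<close> controls\<close>
    have "h / 2 - 2 * C * x = h * (1 - 4 * x) / 2 - 2 * (e * x)"
      by (simp add: C_def algebra_simps)
    then have "- 2 * (e * x) \<le> h / 2 - 2 * C * x" using x e by simp
    then have "?D * (- 2 * (e * x)) \<le> ?D * (h / 2 - 2 * C * x)"
      using D0 by (rule mult_left_mono)
    then have "- (?D * (2 * (e * x))) \<le> ?D * (h / 2 - 2 * C * x)" by simp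
    moreover have "?D * (2 * (e * x)) \<le> (x * 1 * t) * (2 * (e * x))"
      using Dx x e by (intro mult_right_mono) auto
    moreover have "(x * 1 * t) * (2 * (e * x)) = 2 * (e * x\<^sup>2 * t)"
      by (simp add: power2_eq_square)
    moreover have "1000 * (e * x\<^sup>2) * t \<le> h * t"
      using ex et e by (intro mult_right_mono) auto
    moreover have "0 \<le> h * t" using e et by simp
    ultimately have "- (8 / 100) * (h * t) \<le> 32 * (?D * (h / 2 - 2 * C * x))"
      by linarith
    also have "\<dots> = 32 * x * (1 - x) * C * d\<^sup>2 * (h / 2 - 2 * C * x)"
      by (simp only: mult_ac)
    finally show ?thesis .
  qed
  let ?X = "h + 8 * x * (1 - 2 * s) * (h / 2 - C * x)" and ?Y = "t - 2 * C * x * (2 * s - 1)"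
    and ?Z = "32 * x * (1 - x) * C * d\<^sup>2 * (h / 2 - 2 * C * x)"
  have J: "quad_jac a y = 4 * sin (2 * \<beta>) * (?X * ?Y + ?Z)"
    unfolding quad_jac_wedge[OF a] s_def[symmetric] d_def[symmetric] x_def[symmetric] interp_slope_def
      t_def C_def by (simp add: field_simps)
  have "h / 2 * (7 / 10 * t) \<le> ?X * ?Y"
    using X Y e et by (intro mult_mono) auto
  moreover have "h / 2 * (7 / 10 * t) = 35 / 100 * (h * t)" by simp
  moreover have "0 \<le> h * t" using e et by simp
  ultimately have XYZ: "h * t / 4 \<le> ?X * ?Y + ?Z"
    using Z by linarith
  have "e * h / real N \<le> 4 * (1 / real N) * (h * t / 4)"
    using et e by (simp add: mult.commute divide_right_mono)
  also have "\<dots> \<le> 4 * \<bar>sin (2 * \<beta>)\<bar> * (?X * ?Y + ?Z)"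
    using XYZ \<sigma> e et by (intro mult_mono) auto
  also have "\<dots> = \<bar>quad_jac a y\<bar>"
  proof -
    have "0 \<le> h * t / 4" using e et by simp
    then have "0 \<le> ?X * ?Y + ?Z" using XYZ by linarith
    then show ?thesis unfolding J abs_mult[of "4 * _"] by (simp add: abs_mult)
  qed
  finally show ?thesis .
qed

text \<open>
  Here the mixed term has the same sign as the product of slope and radius, so only the two factors
  have to be bounded.
\<close>

lemma quad_jac_wedge_inward_lower_bound:
  fixes y :: "real^2"
  assumes a: "wedge_nodes (e + h) (e + h / 2) e \<beta> a" and N: "2 \<le> N" and \<beta>: "\<bar>\<beta>\<bar> = pi / (4 * real N)"
    and y: "y \<in> ref_triangle" and e: "0 < e" "0 < h"
    and resolved: "1000 * e \<le> h * real N ^ 4"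
  shows "e * h / real N \<le> \<bar>quad_jac a y\<bar>"
proof -
  define s d x where "s = y$1 + y$2" and "d = y$2 - y$1" and "x = (sin \<beta>)\<^sup>2"
  have N0: "0 < N" using N by simp
  have x: "0 \<le> x" "x \<le> 3 / 20" and xN: "x \<le> (1 / real N)\<^sup>2" and \<sigma>: "1 / real N \<le> \<bar>sin (2 * \<beta>)\<bar>"
    using sin_angle_bounds[OF N0 \<beta>] sin_eighth_turn_bound[OF N \<beta>] by (simp_all add: x_def)
  have s: "0 \<le> s" "s \<le> 1"
    using ref_triangle_wedge_coordinates[OF y] by (simp_all add: s_def)
  define t where "t = e + (1 - s) * h"
  have et: "e \<le> t" using s e by (simp add: t_def)
  have ex: "1000 * (e * x\<^sup>2) \<le> h"
    using resolved_imp_quartic_term_small[OF N0 _ x(1) xN resolved] e by simp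
  have s1: "\<bar>1 - 2 * s\<bar> \<le> 1" using s by auto
  have X: "39 / 100 * h \<le> h + 8 * x * (1 - 2 * s) * (h / 2 + e * x)"
  proof -
    have "h + 8 * x * (1 - 2 * s) * (h / 2 + e * x)
        = h + (1 - 2 * s) * (h * (4 * x)) + 8 * ((1 - 2 * s) * (e * x\<^sup>2))"
      by (simp add: algebra_simps power2_eq_square)
    moreover have "\<bar>(1 - 2 * s) * (h * (4 * x))\<bar> \<le> 1 * (h * (60 / 100))"
      unfolding abs_mult using s1 e x by (intro mult_mono) auto
    moreover have "\<bar>(1 - 2 * s) * (e * x\<^sup>2)\<bar> \<le> 1 * (h / 1000)"
      unfolding abs_mult using s1 e ex by (intro mult_mono) auto
    ultimately show ?thesis by linarith
  qed
  have Y: "7 / 10 * t \<le> t - 2 * e * x * (2 * s - 1)"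
  proof -
    have "e * (2 * s - 1) \<le> e * 1" using s e by (intro mult_left_mono) auto
    then have "e * (2 * s - 1) \<le> t" using et by linarith
    then have "2 * x * (e * (2 * s - 1)) \<le> 2 * x * t" using x by (intro mult_left_mono) auto
    also have "\<dots> \<le> (3 / 10) * t" using x et e by (intro mult_right_mono) auto
    finally show ?thesis by (simp add: mult_ac)
  qed
  let ?X = "h + 8 * x * (1 - 2 * s) * (h / 2 + e * x)" and ?Y = "t - 2 * e * x * (2 * s - 1)"
    and ?Z = "32 * x * (1 - x) * e * d\<^sup>2 * (h / 2 + 2 * e * x)"
  have Z: "0 \<le> ?Z" using x e by simp
  have J: "quad_jac a y = - (4 * sin (2 * \<beta>) * (?X * ?Y + ?Z))"
    unfolding quad_jac_wedge[OF a] s_def[symmetric] d_def[symmetric] x_def[symmetric] interp_slope_def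
      t_def by (simp add: field_simps)
  have "39 / 100 * h * (7 / 10 * t) \<le> ?X * ?Y"
    using X Y e et by (intro mult_mono) auto
  moreover have "39 / 100 * h * (7 / 10 * t) = 273 / 1000 * (h * t)" by simp
  moreover have "0 \<le> h * t" using e et by simp
  ultimately have XYZ: "h * t / 4 \<le> ?X * ?Y + ?Z"
    using Z by linarith
  have "e * h / real N \<le> 4 * (1 / real N) * (h * t / 4)"
    using et e by (simp add: mult.commute divide_right_mono)
  also have "\<dots> \<le> 4 * \<bar>sin (2 * \<beta>)\<bar> * (?X * ?Y + ?Z)"
    using XYZ \<sigma> e et by (intro mult_mono) auto
  also have "\<dots> = \<bar>quad_jac a y\<bar>"
  proof -
    have "0 \<le> h * t / 4" using e et by simp
    then have "0 \<le> ?X * ?Y + ?Z" using XYZ by linarith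
    then show ?thesis unfolding J abs_minus abs_mult[of "4 * _"] by (simp add: abs_mult)
  qed
  finally show ?thesis .
qed

section \<open>Profiles and their quadratic interpolation\<close>

text \<open>
  One constant for all bounds on a cavity profile that enter the estimate; the bound \<open>K * R\<close> on the
  slope is what makes the slope small near the origin.
\<close>

definition profile_bounded :: "(real \<Rightarrow> real) \<Rightarrow> real \<Rightarrow> bool" where
  "profile_bounded r K \<longleftrightarrow> 1 \<le> K \<and> smooth_profile r \<and>
     (\<forall>R\<in>{0<..1}. (\<forall>j\<le>3. \<bar>profile_deriv j r R\<bar> \<le> K) \<and>
        0 \<le> profile_deriv 1 r R \<and> profile_deriv 1 r R \<le> K * R)"

lemma cavity_profile_imp_profile_bounded:
  assumes "cavity_profile r"
  obtains K where "profile_bounded r K"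
proof -
  from assms obtain m M where mM: "0 < m" "m < M"
    and slope: "\<And>R. R \<in> {0<..1} \<Longrightarrow> m * R \<le> profile_deriv 1 r R \<and> profile_deriv 1 r R \<le> M * R"
    unfolding cavity_profile_def by blast
  have "\<exists>b. \<forall>R\<in>{0<..1}. \<bar>profile_deriv j r R\<bar> \<le> b" if "j \<le> 3" for j
    using assms that unfolding cavity_profile_def bounded_iff by force
  then obtain b where b: "\<And>j R. j \<le> 3 \<Longrightarrow> R \<in> {0<..1} \<Longrightarrow> \<bar>profile_deriv j r R\<bar> \<le> b j"
    by metis
  define K where "K = Max (insert 1 (insert M (b ` {..3})))"
  have K: "1 \<le> K" "M \<le> K" "\<And>j. j \<le> 3 \<Longrightarrow> b j \<le> K"
    unfolding K_def by (intro Max_ge; simp)+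
  have "profile_bounded r K"
    unfolding profile_bounded_def
  proof (intro conjI ballI allI impI)
    show "1 \<le> K" by fact
    show "smooth_profile r" using assms by (simp add: cavity_profile_def)
    fix R :: real assume R: "R \<in> {0<..1}"
    show "\<bar>profile_deriv j r R\<bar> \<le> K" if "j \<le> 3" for j
      using b[OF that R] K(3)[OF that] by linarith
    show "0 \<le> profile_deriv 1 r R"
      using slope[OF R] mM R mult_nonneg_nonneg[of m R] by (meson greaterThanAtMost_iff less_imp_le order_trans)
    have "M * R \<le> K * R" using K R by (intro mult_right_mono) auto
    then show "profile_deriv 1 r R \<le> K * R" using slope[OF R] by linarith
  qed
  then show thesis by (rule that)
qed

lemma profile_deriv_0 [simp]: "profile_deriv 0 r = r"
  by (simp add: profile_deriv_def)

lemma profile_boundedD: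
  assumes r: "profile_bounded r K" and R: "R \<in> {0<..1}"
  shows "(profile_deriv j r has_real_derivative profile_deriv (Suc j) r R) (at R within {0<..1})"
    and "(r has_real_derivative profile_deriv 1 r R) (at R within {0<..1})"
    and "j \<le> 3 \<Longrightarrow> \<bar>profile_deriv j r R\<bar> \<le> K" and "\<bar>r R\<bar> \<le> K"
    and "0 \<le> profile_deriv 1 r R" and "profile_deriv 1 r R \<le> K * R"
proof -
  show der: "(profile_deriv j r has_real_derivative profile_deriv (Suc j) r R) (at R within {0<..1})" for j
    using r R unfolding profile_bounded_def smooth_profile_def by blast
  show "(r has_real_derivative profile_deriv 1 r R) (at R within {0<..1})"
    using der[of 0] by simp
  show bd: "\<bar>profile_deriv j r R\<bar> \<le> K" if "j \<le> 3" for j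
    using r R that unfolding profile_bounded_def by blast
  show "\<bar>r R\<bar> \<le> K" using bd[of 0] by simp
  show "0 \<le> profile_deriv 1 r R" "profile_deriv 1 r R \<le> K * R"
    using r R unfolding profile_bounded_def by blast+
qed

lemma profile_taylor:
  assumes r: "profile_bounded r K" and w: "w \<in> {0<..1}" and z: "z \<in> {0<..1}"
  shows "\<bar>r z - (r w + profile_deriv 1 r w * (z - w))\<bar> \<le> K * \<bar>z - w\<bar>\<^sup>2"
    and "\<bar>r z - (r w + profile_deriv 1 r w * (z - w) + profile_deriv 2 r w * (z - w)\<^sup>2 / 2)\<bar>
           \<le> K * \<bar>z - w\<bar>^3 / 2"
proof -
  note der = profile_boundedD(1)[OF r]
  have bd: "norm (profile_deriv j r x) \<le> K" if "x \<in> {0<..1}" "j \<le> 3" for j x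
    using profile_boundedD(3)[OF r that] by simp
  show "\<bar>r z - (r w + profile_deriv 1 r w * (z - w))\<bar> \<le> K * \<bar>z - w\<bar>\<^sup>2"
    using field_Taylor[of "{0<..1}" 1 "\<lambda>j. profile_deriv j r" K w z] der bd w z
    by (simp add: numeral_2_eq_2)
  show "\<bar>r z - (r w + profile_deriv 1 r w * (z - w) + profile_deriv 2 r w * (z - w)\<^sup>2 / 2)\<bar>
      \<le> K * \<bar>z - w\<bar>^3 / 2"
    using field_Taylor[of "{0<..1}" 2 "\<lambda>j. profile_deriv j r" K w z] der bd w z
    by (simp add: numeral_2_eq_2 numeral_3_eq_3)
qed

text \<open>
  On radii up to \<open>z\<close> the slope is at most \<open>K * z\<close>, hence the factor \<open>z\<close> in the Lipschitz constant.
\<close>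

lemma profile_lipschitz:
  assumes r: "profile_bounded r K" and a: "0 < a" "a \<le> z" and b: "0 < b" "b \<le> z" and z: "z \<le> 1"
  shows "\<bar>r a - r b\<bar> \<le> K * z * \<bar>a - b\<bar>"
proof -
  have "norm (r a - r b) \<le> K * z * norm (a - b)"
  proof (rule field_differentiable_bound)
    fix x assume x: "x \<in> {0<..z}"
    then have x1: "x \<in> {0<..1}" using z by auto
    show "(r has_real_derivative profile_deriv 1 r x) (at x within {0<..z})"
      using profile_boundedD(2)[OF r x1] z by (auto intro: DERIV_subset)
    have "\<bar>profile_deriv 1 r x\<bar> \<le> K * x"
      using profile_boundedD(5,6)[OF r x1] by linarith
    also have "\<dots> \<le> K * z"
      using r x by (intro mult_left_mono) (auto simp: profile_bounded_def)
    finally show "norm (profile_deriv 1 r x) \<le> K * z" by simp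
  qed (use a b in auto)
  then show ?thesis by simp
qed

lemma profile_times_slope_lipschitz:
  assumes r: "profile_bounded r K" and a: "a \<in> {0<..1}" and b: "b \<in> {0<..1}"
  shows "\<bar>r a * profile_deriv 1 r a - r b * profile_deriv 1 r b\<bar> \<le> 2 * K\<^sup>2 * \<bar>a - b\<bar>"
proof -
  have K: "1 \<le> K" using r by (simp add: profile_bounded_def)
  have "norm (r a * profile_deriv 1 r a - r b * profile_deriv 1 r b) \<le> 2 * K\<^sup>2 * norm (a - b)"
  proof (rule field_differentiable_bound[where S = "{0<..1}"
        and f' = "\<lambda>x. profile_deriv 1 r x * profile_deriv 1 r x + r x * profile_deriv 2 r x"])
    fix x :: real assume x: "x \<in> {0<..1}"
    have d: "(r has_real_derivative profile_deriv 1 r x) (at x within {0<..1})"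
      "(profile_deriv 1 r has_real_derivative profile_deriv 2 r x) (at x within {0<..1})"
      using profile_boundedD(1)[OF r x, of 0] profile_boundedD(1)[OF r x, of 1]
      by (simp_all add: numeral_2_eq_2)
    show "((\<lambda>x. r x * profile_deriv 1 r x) has_real_derivative
        profile_deriv 1 r x * profile_deriv 1 r x + r x * profile_deriv 2 r x) (at x within {0<..1})"
      using DERIV_mult[OF d] by (simp add: mult.commute)
    have bd: "\<bar>r x\<bar> \<le> K" "\<bar>profile_deriv 1 r x\<bar> \<le> K" "\<bar>profile_deriv 2 r x\<bar> \<le> K"
      using profile_boundedD(3)[OF r x] profile_boundedD(4)[OF r x] by simp_all
    have "\<bar>profile_deriv 1 r x * profile_deriv 1 r x\<bar> \<le> K * K" "\<bar>r x * profile_deriv 2 r x\<bar> \<le> K * K"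
      unfolding abs_mult using bd K by (intro mult_mono; simp)+
    then have "\<bar>profile_deriv 1 r x * profile_deriv 1 r x + r x * profile_deriv 2 r x\<bar> \<le> 2 * (K * K)"
      by linarith
    then show "norm (profile_deriv 1 r x * profile_deriv 1 r x + r x * profile_deriv 2 r x) \<le> 2 * K\<^sup>2"
      by (simp add: power2_eq_square)
  qed (use a b in auto)
  then show ?thesis by simp
qed

text \<open>
  Each interpolation formula is exact for polynomials of degree two (slope) or one (value), so only the
  Taylor remainders at the nodes contribute. Values are computed from the pair \<open>B, C\<close> in a
  wedge and from \<open>A, B\<close> in a strip, as these are the combinations that occur in the Jacobians.
\<close>

lemma profile_interpolation:
  assumes r: "profile_bounded r K" and e: "0 < e" "e \<le> 1" "0 < e + h" "e + h \<le> 1"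
    and s: "0 \<le> s" "s \<le> 1"
  defines "A \<equiv> r e" and "B \<equiv> r (e + h / 2)" and "C \<equiv> r (e + h)" and "t \<equiv> e + s * h"
  shows "\<bar>interp_slope A B C s - h * profile_deriv 1 r t\<bar> \<le> 5 * K * \<bar>h\<bar>^3"
    and "\<bar>B * (2 - 2 * s) + C * (2 * s - 1) - r t\<bar> \<le> 3 * K * \<bar>h\<bar>\<^sup>2"
    and "\<bar>A * (1 - 2 * s) + B * (2 * s) - r t\<bar> \<le> 3 * K * \<bar>h\<bar>\<^sup>2"
proof -
  have K: "1 \<le> K" using r by (simp add: profile_bounded_def)
  have inside: "e + u * h \<in> {0<..1}" if "0 \<le> u" "u \<le> 1" for u
    using intermediate_radius[of e h 1 u] e that by simp
  define \<rho>1 where "\<rho>1 u = r (e + u * h) - (r t + profile_deriv 1 r t * ((u - s) * h))" for u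
  define \<rho>2 where "\<rho>2 u = r (e + u * h) -
    (r t + profile_deriv 1 r t * ((u - s) * h) + profile_deriv 2 r t * ((u - s) * h)\<^sup>2 / 2)" for u
  have diff: "e + u * h - t = (u - s) * h" for u by (simp add: t_def algebra_simps)
  have small: "\<bar>(u - s) * h\<bar> \<le> \<bar>h\<bar>" if "0 \<le> u" "u \<le> 1" for u
  proof -
    have "\<bar>u - s\<bar> \<le> 1" using that s by auto
    then show ?thesis by (simp add: abs_mult mult_left_le_one_le)
  qed
  have b1: "\<bar>\<rho>1 u\<bar> \<le> K * \<bar>h\<bar>\<^sup>2" if "0 \<le> u" "u \<le> 1" for u
  proof -
    have "\<bar>\<rho>1 u\<bar> \<le> K * \<bar>(u - s) * h\<bar>\<^sup>2"
      using profile_taylor(1)[OF r inside[OF s] inside[OF that]]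
      unfolding t_def[symmetric] diff \<rho>1_def .
    also have "\<dots> \<le> K * \<bar>h\<bar>\<^sup>2"
      using small[OF that] K by (intro mult_left_mono power_mono) auto
    finally show ?thesis .
  qed
  have b2: "\<bar>\<rho>2 u\<bar> \<le> K * \<bar>h\<bar>^3 / 2" if "0 \<le> u" "u \<le> 1" for u
  proof -
    have "\<bar>\<rho>2 u\<bar> \<le> K * \<bar>(u - s) * h\<bar>^3 / 2"
      using profile_taylor(2)[OF r inside[OF s] inside[OF that]]
      unfolding t_def[symmetric] diff \<rho>2_def .
    also have "\<dots> \<le> K * \<bar>h\<bar>^3 / 2"
      using small[OF that] K by (intro divide_right_mono mult_left_mono power_mono) auto
    finally show ?thesis .
  qed
  \<comment> \<open>\<open>\<rho>1\<close> and \<open>\<rho>2\<close> are the remainders of first and second order at \<open>t\<close>, and each formula is a combination of them with bounded coefficients\<close>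
  have lin: "\<bar>a * x\<bar> \<le> c * b" if "\<bar>a\<bar> \<le> c" "\<bar>x\<bar> \<le> b" for a x b c :: real
    unfolding abs_mult using that by (intro mult_mono) auto
  have "interp_slope A B C s - h * profile_deriv 1 r t
      = (4 * s - 3) * \<rho>2 0 + (4 - 8 * s) * \<rho>2 (1/2) + (4 * s - 1) * \<rho>2 1"
    unfolding interp_slope_def A_def B_def C_def \<rho>2_def by (simp add: field_simps power2_eq_square)
  moreover have "\<bar>(4 * s - 3) * \<rho>2 0\<bar> \<le> 3 * (K * \<bar>h\<bar>^3 / 2)" "\<bar>(4 - 8 * s) * \<rho>2 (1/2)\<bar> \<le> 4 * (K * \<bar>h\<bar>^3 / 2)"
    "\<bar>(4 * s - 1) * \<rho>2 1\<bar> \<le> 3 * (K * \<bar>h\<bar>^3 / 2)"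
    by (rule lin; use s b2 in auto)+
  ultimately show "\<bar>interp_slope A B C s - h * profile_deriv 1 r t\<bar> \<le> 5 * K * \<bar>h\<bar>^3"
    by linarith
  have "B * (2 - 2 * s) + C * (2 * s - 1) - r t = (2 - 2 * s) * \<rho>1 (1/2) + (2 * s - 1) * \<rho>1 1"
    unfolding B_def C_def \<rho>1_def by (simp add: field_simps)
  moreover have "\<bar>(2 - 2 * s) * \<rho>1 (1/2)\<bar> \<le> 2 * (K * \<bar>h\<bar>\<^sup>2)" "\<bar>(2 * s - 1) * \<rho>1 1\<bar> \<le> 1 * (K * \<bar>h\<bar>\<^sup>2)"
    by (rule lin; use s b1 in auto)+
  ultimately show "\<bar>B * (2 - 2 * s) + C * (2 * s - 1) - r t\<bar> \<le> 3 * K * \<bar>h\<bar>\<^sup>2"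
    by linarith
  have "A * (1 - 2 * s) + B * (2 * s) - r t = (1 - 2 * s) * \<rho>1 0 + (2 * s) * \<rho>1 (1/2)"
    unfolding A_def B_def \<rho>1_def by (simp add: field_simps)
  moreover have "\<bar>(1 - 2 * s) * \<rho>1 0\<bar> \<le> 1 * (K * \<bar>h\<bar>\<^sup>2)" "\<bar>(2 * s) * \<rho>1 (1/2)\<bar> \<le> 2 * (K * \<bar>h\<bar>\<^sup>2)"
    by (rule lin; use s b1 in auto)+
  ultimately show "\<bar>A * (1 - 2 * s) + B * (2 * s) - r t\<bar> \<le> 3 * K * \<bar>h\<bar>\<^sup>2"
    by linarith
qed

lemma nodal_scales_identity:
  assumes e: "0 < e" "e \<le> z" "0 < e + h" "e + h \<le> z" "z \<le> 1" and s: "0 \<le> s" "s \<le> 1"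
  shows "nodal_scales z 1 1 z \<bar>h\<bar> e (e + h / 2) (e + h) h (e + s * h)"
  using intermediate_radius[of e h z s] assms by (auto simp: nodal_scales_def)

lemma nodal_scales_profile:
  assumes r: "profile_bounded r K"
    and e: "0 < e" "e \<le> z" "0 < e + h" "e + h \<le> z" "z \<le> 1" and s: "0 \<le> s" "s \<le> 1"
  defines "t \<equiv> e + s * h"
  shows "nodal_scales K (K * z) (5 * K\<^sup>2) z \<bar>h\<bar> (r e) (r (e + h / 2)) (r (e + h))
           (h * profile_deriv 1 r t) (r t)"
proof -
  have K: "1 \<le> K" using r by (simp add: profile_bounded_def)
  have KK: "K \<le> K\<^sup>2" using K by (simp add: self_le_power)
  have z: "0 < z" using e by linarith
  have Kz: "0 \<le> K * z" "K * z \<le> K" using K z e by (auto simp: mult_left_le)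
  have t: "0 < t" "t \<le> z"
    unfolding t_def using intermediate_radius[of e h z s] e s by simp_all
  have bd: "\<bar>r x\<bar> \<le> K" if "0 < x" "x \<le> z" for x
    using profile_boundedD(4)[OF r, of x] that e(5) by simp
  have "\<bar>r (e + h / 2) - r e\<bar> \<le> K * z * \<bar>e + h / 2 - e\<bar>"
    "\<bar>r (e + h) - r (e + h / 2)\<bar> \<le> K * z * \<bar>e + h - (e + h / 2)\<bar>"
    by (rule profile_lipschitz[OF r]; use e in auto)+
  moreover have "K * z * \<bar>e + h / 2 - e\<bar> \<le> K * z * \<bar>h\<bar>" "K * z * \<bar>e + h - (e + h / 2)\<bar> \<le> K * z * \<bar>h\<bar>"
    using Kz by (intro mult_left_mono; auto)+
  moreover have "\<bar>h * profile_deriv 1 r t\<bar> \<le> K * z * \<bar>h\<bar>"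
  proof -
    have "0 \<le> profile_deriv 1 r t" "profile_deriv 1 r t \<le> K * t"
      using profile_boundedD(5,6)[OF r, of t] t e by simp_all
    moreover have "K * t \<le> K * z" using K t by (intro mult_left_mono) auto
    ultimately have "\<bar>h\<bar> * \<bar>profile_deriv 1 r t\<bar> \<le> \<bar>h\<bar> * (K * z)"
      by (intro mult_left_mono) auto
    then show ?thesis by (simp add: abs_mult mult_ac)
  qed
  moreover have "\<bar>r e\<bar> \<le> K" "\<bar>r (e + h / 2)\<bar> \<le> K" "\<bar>r (e + h)\<bar> \<le> K" "\<bar>r t\<bar> \<le> K"
    by (rule bd; use e t in auto)+
  moreover have "K * (K * z) \<le> 5 * K\<^sup>2 * z"
    using z K mult_nonneg_nonneg[of "K\<^sup>2" z] by (simp add: power2_eq_square mult.assoc)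
  moreover have "K \<le> 5 * K\<^sup>2" "K * z \<le> 5 * K\<^sup>2" "1 \<le> 5 * K\<^sup>2"
    using K KK Kz by linarith+
  moreover have "\<bar>h\<bar> \<le> 1" using e by auto
  ultimately show ?thesis
    using Kz by (auto simp: nodal_scales_def)
qed

section \<open>The error between the Jacobians\<close>

text \<open>
  The Jacobian determinant of the cavity map at radius \<open>R\<close>, the product of its two stretches.
\<close>

definition physical_jac :: "(real \<Rightarrow> real) \<Rightarrow> real \<Rightarrow> real" where
  "physical_jac r R = r R * profile_deriv 1 r R / R"

lemma error_scale_nonneg: "0 \<le> z \<Longrightarrow> 0 \<le> \<delta> \<Longrightarrow> 0 \<le> n \<Longrightarrow> 0 \<le> error_scale z \<delta> n"
  by (simp add: error_scale_def)

text \<open>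
  The leading terms cancel up to \<open>c * (r t * r' t - t * f R)\<close>, where \<open>f = physical_jac r\<close>. Comparing with
  \<open>R * f R = r R * r' R\<close> splits the last bracket into an increment of the Lipschitz function \<open>r * r'\<close> and
  \<open>f R * (R - t)\<close>; this avoids the derivative of \<open>f\<close>, which need not be bounded near the origin.
\<close>

lemma jacobian_defect_bound:
  assumes r: "profile_bounded r K"
    and R: "R \<in> {0<..1}" and t: "t \<in> {0<..1}" and Rt: "\<bar>R - t\<bar> \<le> 168 * z * n\<^sup>2"
    and c: "\<bar>c\<bar> \<le> 8 * \<delta> * n" and n: "0 \<le> n" and \<delta>: "0 \<le> \<delta>" and z: "0 \<le> z"
    and F: "\<bar>JF - c * t\<bar> \<le> 3000 * error_scale z \<delta> n"
    and G: "\<bar>JG - c * (r t * profile_deriv 1 r t)\<bar> \<le> 75000 * K^4 * error_scale z \<delta> n"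
  shows "\<bar>JG - physical_jac r R * JF\<bar> \<le> 100000 * K^4 * error_scale z \<delta> n"
proof -
  let ?E = "error_scale z \<delta> n" and ?f = "physical_jac r R" and ?g = "\<lambda>x. r x * profile_deriv 1 r x"
  have K: "1 \<le> K" using r by (simp add: profile_bounded_def)
  have E0: "0 \<le> ?E" using z \<delta> n by (rule error_scale_nonneg)
  have f: "\<bar>?f\<bar> \<le> K\<^sup>2"
  proof -
    have "\<bar>profile_deriv 1 r R\<bar> / R \<le> K"
      using profile_boundedD(5,6)[OF r R] R by (simp add: field_simps)
    then have "\<bar>r R\<bar> * (\<bar>profile_deriv 1 r R\<bar> / R) \<le> K * K"
      using profile_boundedD(4)[OF r R] K R by (intro mult_mono) auto
    then show ?thesis using R by (simp add: physical_jac_def abs_mult power2_eq_square)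
  qed
  have fR: "?f * R = ?g R" using R by (simp add: physical_jac_def)
  define D where "D = (?g t - ?g R) + ?f * (R - t)"
  have "JG - ?f * JF = (JG - c * ?g t) - ?f * (JF - c * t) + c * D"
    using fR by (simp add: D_def algebra_simps)
  moreover have "\<bar>?f * (JF - c * t)\<bar> \<le> K\<^sup>2 * (3000 * ?E)"
    unfolding abs_mult using f F by (intro mult_mono) auto
  moreover have "\<bar>c * D\<bar> \<le> 8 * \<delta> * n * (3 * K\<^sup>2 * (168 * z * n\<^sup>2))"
  proof -
    have "\<bar>?g t - ?g R\<bar> \<le> 2 * K\<^sup>2 * \<bar>t - R\<bar>"
      by (rule profile_times_slope_lipschitz[OF r t R])
    moreover have "\<bar>?f * (R - t)\<bar> \<le> K\<^sup>2 * \<bar>R - t\<bar>"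
      unfolding abs_mult using f by (intro mult_right_mono) auto
    ultimately have "\<bar>D\<bar> \<le> 3 * K\<^sup>2 * \<bar>R - t\<bar>"
      unfolding D_def abs_minus_commute[of t R] mult.assoc by linarith
    also have "\<dots> \<le> 3 * K\<^sup>2 * (168 * z * n\<^sup>2)"
      using Rt by (intro mult_left_mono) auto
    finally show ?thesis
      unfolding abs_mult using c n \<delta> by (intro mult_mono) auto
  qed
  moreover have "8 * \<delta> * n * (3 * K\<^sup>2 * (168 * z * n\<^sup>2)) = 4032 * (K\<^sup>2 * (z * \<delta> * n^3))"
    by (simp add: power2_eq_square power3_eq_cube)
  moreover have "K\<^sup>2 * (z * \<delta> * n^3) \<le> K\<^sup>2 * ?E"
    using n \<delta> z by (intro mult_left_mono) (auto simp: error_scale_def)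
  moreover have "K\<^sup>2 * ?E \<le> K^4 * ?E"
    using K E0 by (intro mult_right_mono power_increasing) auto
  moreover have "0 \<le> K^4 * ?E" using E0 by simp
  ultimately show ?thesis
    using G unfolding mult.assoc by linarith
qed

lemma identity_interpolation:
  fixes e h s :: real
  shows "interp_slope e (e + h / 2) (e + h) s = h"
    and "(e + h / 2) * (2 - 2 * s) + (e + h) * (2 * s - 1) = e + s * h"
    and "e * (1 - 2 * s) + (e + h / 2) * (2 * s) = e + s * h"
  by (simp_all add: interp_slope_def field_simps)

text \<open>
  The two maps have the same leading factor \<open>4 * sin (2 * \<beta>) * h\<close>. The constant \<open>75000\<close> below is
  \<open>3000 * 5\<^sup>2\<close>, since the scales of a profile are controlled by \<open>5 * K\<^sup>2\<close>.
\<close>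

lemma wedge_defect_bound:
  fixes y :: "real^2"
  assumes r: "profile_bounded r K"
    and a: "wedge_nodes e (e + h / 2) (e + h) \<beta> a" and N: "0 < N" and \<beta>: "\<bar>\<beta>\<bar> = pi / (4 * real N)"
    and y: "y \<in> ref_triangle" and disc: "quad_map a y \<in> punctured_disc"
    and e: "0 < e" "e \<le> z" "0 < e + h" "e + h \<le> z" "z \<le> 1"
  shows "\<bar>quad_jac (cavity_map r \<circ> a) y - physical_jac r (norm (quad_map a y)) * quad_jac a y\<bar>
           \<le> 100000 * K^4 * error_scale z \<bar>h\<bar> (1 / real N)"
proof -
  define s t where "s = y$1 + y$2" and "t = e + s * h"
  have K: "1 \<le> K" using r by (simp add: profile_bounded_def)
  have s: "0 \<le> s" "s \<le> 1"
    using ref_triangle_wedge_coordinates[OF y] by (simp_all add: s_def)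
  have le1: "e \<le> 1" "e + h \<le> 1" using e by linarith+
  have KK: "K \<le> K\<^sup>2" using K by (simp add: self_le_power)
  have scale: "5 * K * \<bar>h\<bar>^3 \<le> 5 * K\<^sup>2 * \<bar>h\<bar>^3" "3 * K * \<bar>h\<bar>\<^sup>2 \<le> 5 * K\<^sup>2 * \<bar>h\<bar>\<^sup>2"
    using KK K by (intro mult_right_mono; simp)+
  have ra: "wedge_nodes (r e) (r (e + h / 2)) (r (e + h)) \<beta> (cavity_map r \<circ> a)"
    using wedge_nodes_cavity_map[OF a] e by simp
  show ?thesis
  proof (rule jacobian_defect_bound[OF r, where c = "4 * sin (2 * \<beta>) * h" and t = t])
    show "norm (quad_map a y) \<in> {0<..1}" using disc by (simp add: punctured_disc_def)
    show "t \<in> {0<..1}" using intermediate_radius[of e h z s] e s by (simp add: t_def)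
    show "\<bar>norm (quad_map a y) - t\<bar> \<le> 168 * z * (1 / real N)\<^sup>2"
      using norm_quad_map_wedge[OF a N \<beta> y, of z] e by (simp add: t_def s_def)
    show "\<bar>4 * sin (2 * \<beta>) * h\<bar> \<le> 8 * \<bar>h\<bar> * (1 / real N)"
      using mult_right_mono[OF sin_angle_bounds(4)[OF N \<beta>], of "4 * \<bar>h\<bar>"]
      by (simp add: abs_mult mult_ac)
    show "\<bar>quad_jac a y - 4 * sin (2 * \<beta>) * h * t\<bar> \<le> 3000 * error_scale z \<bar>h\<bar> (1 / real N)"
      using quad_jac_wedge_estimate[OF a N \<beta> y nodal_scales_identity[OF e s]]
      unfolding identity_interpolation by (simp add: s_def t_def mult.assoc)
    show "\<bar>quad_jac (cavity_map r \<circ> a) y - 4 * sin (2 * \<beta>) * h * (r t * profile_deriv 1 r t)\<bar>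
        \<le> 75000 * K^4 * error_scale z \<bar>h\<bar> (1 / real N)"
      using quad_jac_wedge_estimate[OF ra N \<beta> y nodal_scales_profile[OF r e s]]
        order_trans[OF profile_interpolation(1)[OF r e(1) le1(1) e(3) le1(2) s] scale(1)]
        order_trans[OF profile_interpolation(2)[OF r e(1) le1(1) e(3) le1(2) s] scale(2)]
      by (simp add: s_def t_def mult_ac power_mult_distrib flip: power_mult)
  qed (use e in auto)
qed

lemma strip_defect_bound:
  fixes y :: "real^2"
  assumes r: "profile_bounded r K"
    and a: "strip_nodes e (e + h / 2) (e + h) \<beta> a" and N: "0 < N" and \<beta>: "\<bar>\<beta>\<bar> = pi / (4 * real N)"
    and y: "y \<in> ref_triangle" and disc: "quad_map a y \<in> punctured_disc"
    and e: "0 < e" "0 < h" "e + h \<le> 1"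
  shows "\<bar>quad_jac (cavity_map r \<circ> a) y - physical_jac r (norm (quad_map a y)) * quad_jac a y\<bar>
           \<le> 100000 * K^4 * error_scale (e + h) h (1 / real N)"
proof -
  define s t where "s = y$1" and "t = e + s * h"
  define z where "z = e + h"
  have K: "1 \<le> K" using r by (simp add: profile_bounded_def)
  have s: "0 \<le> s" "s \<le> 1" using y by (auto simp: ref_triangle_def s_def)
  have ez: "0 < e" "e \<le> z" "0 < e + h" "e + h \<le> z" "z \<le> 1" using e by (simp_all add: z_def)
  have le1: "e \<le> 1" using e by linarith
  have KK: "K \<le> K\<^sup>2" using K by (simp add: self_le_power)
  have scale: "5 * K * \<bar>h\<bar>^3 \<le> 5 * K\<^sup>2 * \<bar>h\<bar>^3" "3 * K * \<bar>h\<bar>\<^sup>2 \<le> 5 * K\<^sup>2 * \<bar>h\<bar>\<^sup>2"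
    using KK K by (intro mult_right_mono; simp)+
  have ra: "strip_nodes (r e) (r (e + h / 2)) (r (e + h)) \<beta> (cavity_map r \<circ> a)"
    using strip_nodes_cavity_map[OF a] e by simp
  have "\<bar>quad_jac (cavity_map r \<circ> a) y - physical_jac r (norm (quad_map a y)) * quad_jac a y\<bar>
      \<le> 100000 * K^4 * error_scale z \<bar>h\<bar> (1 / real N)"
  proof (rule jacobian_defect_bound[OF r, where c = "2 * sin (2 * \<beta>) * h" and t = t])
    show "norm (quad_map a y) \<in> {0<..1}" using disc by (simp add: punctured_disc_def)
    show "t \<in> {0<..1}" using intermediate_radius[of e h z s] ez s by (simp add: t_def)
    show "\<bar>norm (quad_map a y) - t\<bar> \<le> 168 * z * (1 / real N)\<^sup>2"
      using norm_quad_map_strip[OF a N \<beta> y e(1,2), of z] by (simp add: t_def s_def z_def)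
    have "\<bar>2 * sin (2 * \<beta>) * h\<bar> \<le> 4 * \<bar>h\<bar> * (1 / real N)"
      using mult_right_mono[OF sin_angle_bounds(4)[OF N \<beta>], of "2 * \<bar>h\<bar>"]
      by (simp add: abs_mult mult_ac)
    also have "\<dots> \<le> 8 * \<bar>h\<bar> * (1 / real N)" by (intro mult_right_mono) auto
    finally show "\<bar>2 * sin (2 * \<beta>) * h\<bar> \<le> 8 * \<bar>h\<bar> * (1 / real N)" .
    show "\<bar>quad_jac a y - 2 * sin (2 * \<beta>) * h * t\<bar> \<le> 3000 * error_scale z \<bar>h\<bar> (1 / real N)"
      using quad_jac_strip_estimate[OF a N \<beta> y nodal_scales_identity[OF ez s]]
      unfolding identity_interpolation by (simp add: s_def t_def mult.assoc)
    show "\<bar>quad_jac (cavity_map r \<circ> a) y - 2 * sin (2 * \<beta>) * h * (r t * profile_deriv 1 r t)\<bar>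
        \<le> 75000 * K^4 * error_scale z \<bar>h\<bar> (1 / real N)"
      using quad_jac_strip_estimate[OF ra N \<beta> y nodal_scales_profile[OF r ez s]]
        order_trans[OF profile_interpolation(1)[OF r e(1) le1 ez(3) e(3) s] scale(1)]
        order_trans[OF profile_interpolation(3)[OF r e(1) le1 ez(3) e(3) s] scale(2)]
      by (simp add: s_def t_def mult_ac power_mult_distrib flip: power_mult)
  qed (use ez in auto)
  then show ?thesis using e by (simp add: z_def)
qed

text \<open>
  The point of this form is that all derivatives with respect to the physical variable are gone.
\<close>

lemma jac_error_eq:
  assumes r: "profile_bounded r K" and wp: "well_posed_at k \<epsilon> \<tau> N y"
  defines "a \<equiv> rep_node k \<epsilon> \<tau> N"
  shows "jac_error r k \<epsilon> \<tau> N y =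
    (quad_jac (cavity_map r \<circ> a) y - physical_jac r (norm (quad_map a y)) * quad_jac a y) / quad_jac a y"
proof -
  have y: "y \<in> ref_triangle" and inj: "inj_on (quad_map a) ref_triangle"
    and disc: "quad_map a y \<in> punctured_disc" and J: "quad_jac a y \<noteq> 0"
    using wp unfolding well_posed_at_def elem_jac_eq_quad_jac elem_map_def a_def by auto
  have "det (jacobian (iso_interp (cavity_map r) a) (at (quad_map a y) within quad_map a ` ref_triangle))
      = quad_jac (cavity_map r \<circ> a) y / quad_jac a y"
    unfolding iso_interp_def quad_jac_def
    using det_jacobian_composed_with_inverse[OF has_derivative_quad_map has_derivative_quad_map inj y]
      J[unfolded quad_jac_def] by blast
  moreover have "det (jacobian (cavity_map r) (at (quad_map a y) within punctured_disc))
      = physical_jac r (norm (quad_map a y))"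
    unfolding physical_jac_def
  proof (rule det_jacobian_radial_map[OF _ disc])
    show "(r has_real_derivative profile_deriv 1 r (norm (quad_map a y))) (at (norm (quad_map a y)) within {0<..1})"
      using disc by (intro profile_boundedD(2)[OF r]) (simp add: punctured_disc_def)
  qed
  ultimately show ?thesis
    unfolding jac_error_def elem_map_def a_def[symmetric] using J by (simp add: diff_divide_distrib)
qed

text \<open>
  For \<open>N = 1\<close> the two vertices at angles \<open>\<plusminus>\<pi>\<close> coincide.
\<close>

lemma one_sector_wedge_not_injective:
  assumes "k \<in> {Type_A, Type_B}"
  shows "\<not> inj_on (quad_map (rep_node k \<epsilon> \<tau> 1)) ref_triangle"
proof
  let ?a = "rep_node k \<epsilon> \<tau> 1"
  assume inj: "inj_on (quad_map ?a) ref_triangle"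
  have "quad_map ?a (vector [1, 0]) = ?a V2" "quad_map ?a (vector [0, 1]) = ?a V3"
    by (simp_all add: quad_map_def bary1_def bary2_def bary3_def)
  moreover have "?a V2 = ?a V3"
    using assms by (auto simp: polar_pt_def)
  moreover have "vector [1, 0] \<in> ref_triangle" "vector [0, 1] \<in> ref_triangle"
    by (simp_all add: ref_triangle_def)
  ultimately have "vector [1, 0] = (vector [0, 1] :: real^2)"
    using inj by (metis inj_onD)
  then have "(vector [1, 0] :: real^2) $ 1 = (vector [0, 1] :: real^2) $ 1" by simp
  then show False by simp
qed

text \<open>
  Type B is a wedge with \<open>h = - \<tau>\<close> and reversed orientation. Type D is a reflected
  strip; the reflection changes the sign of both Jacobians, which leaves the estimates intact.
\<close>

lemma element_defect_and_lower_bound: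
  fixes y :: "real^2"
  assumes r: "profile_bounded r K" and \<epsilon>: "0 < \<epsilon>" and \<tau>: "0 < \<tau>" and \<epsilon>\<tau>: "\<epsilon> + \<tau> \<le> 1" and N: "0 < N"
    and wp: "well_posed_at k \<epsilon> \<tau> N y"
  defines "a \<equiv> rep_node k \<epsilon> \<tau> N"
  shows "\<bar>quad_jac (cavity_map r \<circ> a) y - physical_jac r (norm (quad_map a y)) * quad_jac a y\<bar>
           \<le> 100000 * K^4 * error_scale (\<epsilon> + \<tau>) \<tau> (1 / real N)" (is ?defect)
    and "resolved 1000 k \<epsilon> \<tau> N \<Longrightarrow> \<epsilon> * \<tau> / real N \<le> \<bar>quad_jac a y\<bar>" (is "_ \<Longrightarrow> ?lower")
proof -
  have y: "y \<in> ref_triangle" and inj: "inj_on (quad_map a) ref_triangle"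
    and disc: "quad_map a y \<in> punctured_disc"
    using wp unfolding well_posed_at_def elem_map_def a_def by auto
  have N2: "2 \<le> N" if "k \<in> {Type_A, Type_B}"
  proof (rule ccontr)
    assume "\<not> 2 \<le> N"
    then have "N = 1" using N by simp
    then show False using one_sector_wedge_not_injective[OF that] inj by (simp add: a_def)
  qed
  have \<beta>: "\<bar>pi / (4 * real N)\<bar> = pi / (4 * real N)" "\<bar>- pi / (4 * real N)\<bar> = pi / (4 * real N)"
    by simp_all
  have "?defect \<and> (resolved 1000 k \<epsilon> \<tau> N \<longrightarrow> ?lower)"
  proof (cases k)
    case Type_A
    have w: "wedge_nodes \<epsilon> (\<epsilon> + \<tau> / 2) (\<epsilon> + \<tau>) (pi / (4 * real N)) a"
      unfolding a_def Type_A by (rule rep_node_wedge_or_strip)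
    show ?thesis
      using wedge_defect_bound[OF r w N \<beta>(1) y disc, of "\<epsilon> + \<tau>"] \<epsilon> \<tau> \<epsilon>\<tau>
        quad_jac_wedge_outward_lower_bound[OF w _ \<beta>(1) y \<epsilon> \<tau>] N2
      by (simp add: Type_A resolved_def)
  next
    case Type_B
    have w: "wedge_nodes (\<epsilon> + \<tau>) (\<epsilon> + \<tau> / 2) \<epsilon> (- pi / (4 * real N)) a"
      unfolding a_def Type_B by (rule rep_node_wedge_or_strip)
    have eq: "\<epsilon> + \<tau> + (- \<tau>) / 2 = \<epsilon> + \<tau> / 2" "\<epsilon> + \<tau> + (- \<tau>) = \<epsilon>"
      by (simp_all add: field_simps)
    have w': "wedge_nodes (\<epsilon> + \<tau>) (\<epsilon> + \<tau> + (- \<tau>) / 2) (\<epsilon> + \<tau> + (- \<tau>)) (- pi / (4 * real N)) a"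
      unfolding eq by (rule w)
    show ?thesis
      using wedge_defect_bound[OF r w' N \<beta>(2) y disc, of "\<epsilon> + \<tau>"] \<epsilon> \<tau> \<epsilon>\<tau>
        quad_jac_wedge_inward_lower_bound[OF w _ \<beta>(2) y \<epsilon> \<tau>] N2
      by (simp add: Type_B resolved_def)
  next
    case Type_C
    have w: "strip_nodes \<epsilon> (\<epsilon> + \<tau> / 2) (\<epsilon> + \<tau>) (pi / (4 * real N)) a"
      unfolding a_def Type_C by (rule rep_node_wedge_or_strip)
    show ?thesis
      using strip_defect_bound[OF r w N \<beta>(1) y disc \<epsilon> \<tau> \<epsilon>\<tau>]
        quad_jac_strip_lower_bound[OF w N \<beta>(1) y \<epsilon> \<tau>] by simp
  next
    case Type_D
    define y' :: "real^2" where "y' = vector [y$2, y$1]"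
    have w: "strip_nodes \<epsilon> (\<epsilon> + \<tau> / 2) (\<epsilon> + \<tau>) (- pi / (4 * real N)) (a \<circ> node_swap)"
      unfolding a_def Type_D by (rule rep_node_wedge_or_strip)
    have y': "y' \<in> ref_triangle" using y by (simp add: ref_triangle_def y'_def add.commute)
    have yy: "vector [y'$2, y'$1] = y" by (simp add: y'_def vec_eq_iff forall_2)
    have m: "quad_map (b \<circ> node_swap) y' = quad_map b y" "quad_jac (b \<circ> node_swap) y' = - quad_jac b y" for b
      unfolding quad_map_swap quad_jac_swap yy by simp_all
    have "\<bar>- quad_jac (cavity_map r \<circ> a) y - physical_jac r (norm (quad_map a y)) * - quad_jac a y\<bar>
           \<le> 100000 * K^4 * error_scale (\<epsilon> + \<tau>) \<tau> (1 / real N)"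
      using strip_defect_bound[OF r w N \<beta>(2) y' _ \<epsilon> \<tau> \<epsilon>\<tau>] disc by (simp add: m flip: o_assoc) (simp add: m o_assoc)
    then have ?defect by (simp add: abs_minus_commute)
    moreover have ?lower
      using quad_jac_strip_lower_bound[OF w N \<beta>(2) y' \<epsilon> \<tau>] by (simp add: m)
    ultimately show ?thesis by blast
  qed
  then show ?defect "resolved 1000 k \<epsilon> \<tau> N \<Longrightarrow> ?lower" by auto
qed

text \<open>
  Beyond the three terms on the right the quotient contains \<open>\<tau> * n\<^sup>2 / \<epsilon>\<close>, which the inequality between
  arithmetic and geometric means absorbs into the last two.
\<close>

lemma error_scale_relative_bound:
  assumes "0 < \<epsilon>" "0 < \<tau>" "\<epsilon> + \<tau> \<le> 1" "0 < (n::real)"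
  shows "error_scale (\<epsilon> + \<tau>) \<tau> n / (\<epsilon> * \<tau> * n) \<le> 2 * (n\<^sup>2 + \<tau>\<^sup>2 / \<epsilon> + n^4 / (\<epsilon> * \<tau>))"
proof -
  have "error_scale (\<epsilon> + \<tau>) \<tau> n / (\<epsilon> * \<tau> * n) = n\<^sup>2 + \<tau>\<^sup>2 / \<epsilon> + n^4 / (\<epsilon> * \<tau>) + \<tau> * n\<^sup>2 / \<epsilon>"
    using assms by (simp add: error_scale_def field_simps eval_nat_numeral)
  moreover have "\<tau> * n\<^sup>2 / \<epsilon> \<le> \<tau>\<^sup>2 / \<epsilon> + n^4 / (\<epsilon> * \<tau>)"
  proof -
    have "0 \<le> (\<tau> - n\<^sup>2)\<^sup>2" by simp
    then have "2 * (\<tau> * n\<^sup>2) \<le> \<tau>\<^sup>2 + n^4"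
      by (simp add: power2_diff flip: power_mult)
    moreover have "0 \<le> \<tau> * n\<^sup>2" using assms by simp
    ultimately have "\<tau> * n\<^sup>2 \<le> \<tau>\<^sup>2 + n^4" by linarith
    also have "\<dots> \<le> \<tau>\<^sup>2 + n^4 / \<tau>"
    proof -
      have "n^4 * \<tau> \<le> n^4 * 1" using assms by (intro mult_left_mono) auto
      then show ?thesis using assms by (simp add: pos_le_divide_eq)
    qed
    finally have "\<tau> * n\<^sup>2 / \<epsilon> \<le> (\<tau>\<^sup>2 + n^4 / \<tau>) / \<epsilon>"
      using assms by (intro divide_right_mono) auto
    then show ?thesis by (simp add: add_divide_distrib mult.commute)
  qed
  moreover have "c + a + b + x \<le> 2 * (c + a + b)" if "x \<le> a + b" "0 \<le> c" for a b c x :: real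
    using that by (simp add: distrib_left)
  ultimately show ?thesis by (metis zero_le_power2)
qed

theorem theorem3p3:
  shows "\<exists>K>0. \<forall>r. cavity_profile r \<longrightarrow>
    (\<exists>C>0. \<forall>k \<epsilon> \<tau> N y.
       0 < \<epsilon> \<and> 0 < \<tau> \<and> \<epsilon> + \<tau> \<le> 1 \<and> 0 < N \<and> well_posed_at k \<epsilon> \<tau> N y \<longrightarrow>
         \<bar>jac_error r k \<epsilon> \<tau> N y\<bar>
           \<le> C * (\<tau>^3 / real N + (\<epsilon> + \<tau>) * \<tau> / real N ^ 3 + 1 / real N ^ 5)
               / \<bar>elem_jac k \<epsilon> \<tau> N y\<bar> \<and>
         (resolved K k \<epsilon> \<tau> N \<longrightarrow>
           \<bar>jac_error r k \<epsilon> \<tau> N y\<bar>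
             \<le> C * (1 / real N ^ 2 + \<tau>^2 / \<epsilon> + 1 / (\<epsilon> * \<tau> * real N ^ 4))))"
proof (rule exI[of _ 1000], intro conjI allI impI)
  fix r assume "cavity_profile r"
  then obtain K where r: "profile_bounded r K"
    by (rule cavity_profile_imp_profile_bounded)
  then have K: "1 \<le> K" by (simp add: profile_bounded_def)
  define C where "C = 100000 * K^4"
  have C: "0 < C" using K by (simp add: C_def)
  have main: "\<bar>jac_error r k \<epsilon> \<tau> N y\<bar> \<le> 2 * C * (\<tau>^3 / real N + (\<epsilon> + \<tau>) * \<tau> / real N ^ 3 + 1 / real N ^ 5)
               / \<bar>elem_jac k \<epsilon> \<tau> N y\<bar>" (is ?first)
    "resolved 1000 k \<epsilon> \<tau> N \<Longrightarrow> \<bar>jac_error r k \<epsilon> \<tau> N y\<bar>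
             \<le> 2 * C * (1 / real N ^ 2 + \<tau>^2 / \<epsilon> + 1 / (\<epsilon> * \<tau> * real N ^ 4))" (is "_ \<Longrightarrow> ?second")
    if h: "0 < \<epsilon>" "0 < \<tau>" "\<epsilon> + \<tau> \<le> 1" "0 < N" "well_posed_at k \<epsilon> \<tau> N y" for k \<epsilon> \<tau> N y
  proof -
    define J E where "J = elem_jac k \<epsilon> \<tau> N y" and "E = error_scale (\<epsilon> + \<tau>) \<tau> (1 / real N)"
    have E: "E = \<tau>^3 / real N + (\<epsilon> + \<tau>) * \<tau> / real N ^ 3 + 1 / real N ^ 5"
      by (simp add: E_def error_scale_def power_divide)
    have E0: "0 \<le> E" unfolding E_def using h by (intro error_scale_nonneg) auto
    note el = element_defect_and_lower_bound[OF r h, folded elem_jac_eq_quad_jac C_def]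
    have err: "\<bar>jac_error r k \<epsilon> \<tau> N y\<bar> \<le> C * E / \<bar>J\<bar>"
      unfolding jac_error_eq[OF r h(5)] abs_divide elem_jac_eq_quad_jac[symmetric] J_def E_def
      using el(1) by (intro divide_right_mono) auto
    also have "\<dots> \<le> 2 * C * E / \<bar>J\<bar>"
      using C E0 by (intro divide_right_mono mult_right_mono) auto
    finally show ?first unfolding E J_def .
    assume "resolved 1000 k \<epsilon> \<tau> N"
    from el(2)[OF this] have lower: "\<epsilon> * \<tau> * (1 / real N) \<le> \<bar>J\<bar>" by (simp add: J_def)
    have pos: "0 < \<epsilon> * \<tau> * (1 / real N)" using h by simp
    with lower have "0 < \<bar>J\<bar>" by linarith
    with pos have "C * E / \<bar>J\<bar> \<le> C * E / (\<epsilon> * \<tau> * (1 / real N))"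
      using C E0 by (intro divide_left_mono[OF lower] mult_pos_pos[of "\<bar>J\<bar>"] mult_nonneg_nonneg) auto
    also have "\<dots> = C * (E / (\<epsilon> * \<tau> * (1 / real N)))" by simp
    also have "\<dots> \<le> C * (2 * ((1 / real N)\<^sup>2 + \<tau>\<^sup>2 / \<epsilon> + (1 / real N)^4 / (\<epsilon> * \<tau>)))"
      unfolding E_def using C h by (intro mult_left_mono error_scale_relative_bound) auto
    also have "\<dots> = 2 * C * (1 / real N ^ 2 + \<tau>^2 / \<epsilon> + 1 / (\<epsilon> * \<tau> * real N ^ 4))"
      by (simp add: power_divide mult.commute)
    finally show ?second using err by linarith
  qed
  show "\<exists>C>0. \<forall>k \<epsilon> \<tau> N y.
       0 < \<epsilon> \<and> 0 < \<tau> \<and> \<epsilon> + \<tau> \<le> 1 \<and> 0 < N \<and> well_posed_at k \<epsilon> \<tau> N y \<longrightarrow>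
         \<bar>jac_error r k \<epsilon> \<tau> N y\<bar>
           \<le> C * (\<tau>^3 / real N + (\<epsilon> + \<tau>) * \<tau> / real N ^ 3 + 1 / real N ^ 5)
               / \<bar>elem_jac k \<epsilon> \<tau> N y\<bar> \<and>
         (resolved 1000 k \<epsilon> \<tau> N \<longrightarrow>
           \<bar>jac_error r k \<epsilon> \<tau> N y\<bar>
             \<le> C * (1 / real N ^ 2 + \<tau>^2 / \<epsilon> + 1 / (\<epsilon> * \<tau> * real N ^ 4)))"
    using C main by (intro exI[of _ "2 * C"] conjI allI impI) auto
qed simp

end
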